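(* Let $q_1,\ldots,q_k$ be a finite list of permutations (forbidden patterns). Then the set of (nonempty) permutations which avoid all of $q_1,\ldots,q_k$ can be encoded as a language that is accepted by a linear-bounded automaton in polynomial time. Precisely: under the $it$-encoding, the set of permutations of $\{1,\ldots,n\}$, $n\ge 1$, avoiding all of $q_1,\ldots,q_k$ is in bijection with the language $E(q_1)\cap\cdots\cap E(q_k)\subseteq\{l,r,m,f,t\}^*$ of $it$-codewords representing them, and there is a linear-bounded automaton accepting exactly this language and running in a number of steps bounded by a polynomial in the length of the input.
   Context: Permutations and patterns. A permutation is a finite ordered list of distinct real numbers. Two permutations $p_1\ldots p_n$ and $q_1\ldots q_n$ of the same length are order isomorphic if $p_i<p_j\iff q_i<q_j$ for all $1\le i<j\le n$. A permutation $p_1\ldots p_n$ contains a pattern $q=q_1\ldots q_k$ if $k\le n$ and some subsequence $p_{i_1}\ldots p_{i_k}$ ($i_1<\cdots<i_k$) is order isomorphic to $q$; otherwise $p$ avoids $q$. $it$-encoding ("insert and translate"). A codeword is a string $w$ over the alphabet $\{l,r,m,f,t\}$ such that (1) for each occurrence in $w$ of a letter $x\in\{l,r,m,f\}$, the number of letters $t$ immediately preceding $x$ (the maximal run of $t$'s just before $x$) is at most $k$, where $k$ is the number of $m$'s minus the number of $f$'s occurring in $w$ to the left of $x$ (in particular $k\ge 0$); (2) $w$ ends with an $f$; and (3) the number of $f$'s in $w$ is one more than the number of $m$'s, i.e. all slots are filled at the end of the procedure below. A codeword represents the permutation $p$ of $\{1,\ldots,n\}$ ($n$ = number of non-$t$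 letters of $w$) obtained as follows. Start with $p=\diamond$ (a single open slot), $i=1$, next slot $=1$ (slots $\diamond$ are numbered from left to right). Read the letters of $w$ from left to right: - on $t$: increase the next slot by $1$; - on $l$: replace the next slot by $i\,\diamond$; - on $r$: replace the next slot by $\diamond\, i$; - on $m$: replace the next slot by $\diamond\, i\,\diamond$; - on $f$: replace the next slot by $i$; after each of $l,r,m,f$, increase $i$ by $1$ and reset the next slot to $1$. $E$ denotes the set of all codewords, and, for a permutation $q$, $E(q)\subseteq E$ denotes the set of codewords representing permutations that avoid $q$. A linear-bounded automaton is a (possibly nondeterministic) Turing machine, with a finite tape alphabet, whose computation on an input $w$ uses only the tape squares on which $w$ is written (up to end-markers, or at most one additional square). *)

theory Defs
  imports Complex_Main "HOL-Library.Sublist" "HOL-Computational_Algebra.Polynomial"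
begin

section \<open>Permutations and patterns\<close>

definition is_perm :: "real list \<Rightarrow> bool" where
  "is_perm p \<longleftrightarrow> distinct p"

definition order_isomorphic :: "real list \<Rightarrow> real list \<Rightarrow> bool" where
  "order_isomorphic p q \<longleftrightarrow>
     length p = length q \<and> (\<forall>i j. i < j \<and> j < length p \<longrightarrow> (p ! i < p ! j \<longleftrightarrow> q ! i < q ! j))"

definition contains_pattern :: "real list \<Rightarrow> real list \<Rightarrow> bool" where
  "contains_pattern p q \<longleftrightarrow> (\<exists>s. subseq s p \<and> order_isomorphic s q)"

definition avoids :: "real list \<Rightarrow> real list \<Rightarrow> bool" where
  "avoids p q \<longleftrightarrow> \<not> contains_pattern p q"

definition perms_of :: "nat \<Rightarrow> real list set" where
  "perms_of n = {p. is_perm p \<and> set p = real ` {1..n}}"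


section \<open>The insert-and-translate encoding\<close>

datatype it_letter = Ll | Lr | Lm | Lf | Lt

definition trailing_ts :: "it_letter list \<Rightarrow> nat" where
  "trailing_ts w = length (takeWhile (\<lambda>x. x = Lt) (rev w))"

definition it_codewords :: "it_letter list set" where
  "it_codewords = {w.
     (\<forall>i < length w. w ! i \<noteq> Lt \<longrightarrow>
        int (trailing_ts (take i w))
          \<le> int (count_list (take i w) Lm) - int (count_list (take i w) Lf)) \<and>
     w \<noteq> [] \<and> last w = Lf \<and>
     count_list w Lf = count_list w Lm + 1}"

text \<open>
  During decoding, \<^const>\<open>None\<close> stands for an open slot and \<^term>\<open>Some x\<close> for the entry \<open>x\<close>.
  Slots are counted from the left, starting with 1.
\<close>

fun replace_slot :: "nat \<Rightarrow> real option list \<Rightarrow> real option list \<Rightarrow> real option list" where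
  "replace_slot k b [] = []"
| "replace_slot k b (Some x # p) = Some x # replace_slot k b p"
| "replace_slot k b (None # p) = (if k = 1 then b @ p else None # replace_slot (k - 1) b p)"

text \<open>The state consists of the partially filled permutation, the counter \<open>i\<close> and the next slot.\<close>

fun it_step :: "it_letter \<Rightarrow> real option list \<times> nat \<times> nat \<Rightarrow> real option list \<times> nat \<times> nat" where
  "it_step Lt (p, i, s) = (p, i, s + 1)"
| "it_step Ll (p, i, s) = (replace_slot s [Some (real i), None] p, i + 1, 1)"
| "it_step Lr (p, i, s) = (replace_slot s [None, Some (real i)] p, i + 1, 1)"
| "it_step Lm (p, i, s) = (replace_slot s [None, Some (real i), None] p, i + 1, 1)"
| "it_step Lf (p, i, s) = (replace_slot s [Some (real i)] p, i + 1, 1)"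

text \<open>On codewords no open slot is left at the end, so \<^const>\<open>the\<close> is only applied to entries.\<close>

definition it_perm :: "it_letter list \<Rightarrow> real list" where
  "it_perm w = map the (fst (fold it_step w ([None], 1, 1)))"

definition it_avoiding :: "real list \<Rightarrow> it_letter list set" where
  "it_avoiding q = {w \<in> it_codewords. avoids (it_perm w) q}"


section \<open>Linear-bounded automata\<close>

text \<open>
  The tape holds the input word between two end-markers and never changes its length. Its alphabet
  consists of the end-markers, the letters of the input alphabet and finitely many further symbols.
\<close>

datatype ('a, 'g) tape_symbol = LeftEnd | RightEnd | Letter 'a | Aux 'g

datatype move = MoveLeft | Stay | MoveRight

record ('q, 'a, 'g) lba =
  lba_states :: "'q set"
  lba_aux :: "'g set"
  lba_start :: 'q
  lba_accepting :: "'q set"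
  lba_trans :: "('q \<times> ('a, 'g) tape_symbol \<times> 'q \<times> ('a, 'g) tape_symbol \<times> move) set"

definition tape_alphabet :: "('q, 'a, 'g) lba \<Rightarrow> ('a, 'g) tape_symbol set" where
  "tape_alphabet M = {LeftEnd, RightEnd} \<union> range Letter \<union> Aux ` lba_aux M"

text \<open>
  A transition \<open>(q, a, q', b, d)\<close> may be taken in state \<open>q\<close> when \<open>a\<close> is scanned; it writes \<open>b\<close>,
  moves the head in direction \<open>d\<close> and enters state \<open>q'\<close>. There is no determinism requirement.
\<close>

definition is_lba :: "('q, 'a, 'g) lba \<Rightarrow> bool" where
  "is_lba M \<longleftrightarrow>
     finite (lba_states M) \<and> finite (tape_alphabet M) \<and>
     lba_start M \<in> lba_states M \<and> lba_accepting M \<subseteq> lba_states M \<and>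
     (\<forall>(q, a, q', b, d) \<in> lba_trans M.
        q \<in> lba_states M \<and> q' \<in> lba_states M \<and> a \<in> tape_alphabet M \<and> b \<in> tape_alphabet M \<and>
        (a = LeftEnd \<longleftrightarrow> b = LeftEnd) \<and> (a = RightEnd \<longleftrightarrow> b = RightEnd) \<and>
        (a = LeftEnd \<longrightarrow> d \<noteq> MoveLeft) \<and> (a = RightEnd \<longrightarrow> d \<noteq> MoveRight))"

text \<open>A configuration consists of the state, the tape and the head position (0 is the left end).\<close>

type_synonym ('q, 'a, 'g) lba_config = "'q \<times> ('a, 'g) tape_symbol list \<times> nat"

definition lba_initial :: "('q, 'a, 'g) lba \<Rightarrow> 'a list \<Rightarrow> ('q, 'a, 'g) lba_config" where
  "lba_initial M w = (lba_start M, LeftEnd # map Letter w @ [RightEnd], 1)"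

fun move_head :: "move \<Rightarrow> nat \<Rightarrow> nat" where
  "move_head MoveLeft h = h - 1"
| "move_head Stay h = h"
| "move_head MoveRight h = h + 1"

inductive lba_step ::
  "('q, 'a, 'g) lba \<Rightarrow> ('q, 'a, 'g) lba_config \<Rightarrow> ('q, 'a, 'g) lba_config \<Rightarrow> bool"
  for M where
  "\<lbrakk>h < length tp; (q, tp ! h, q', b, d) \<in> lba_trans M\<rbrakk> \<Longrightarrow>
     lba_step M (q, tp, h) (q', tp[h := b], move_head d h)"

definition lba_language :: "('q, 'a, 'g) lba \<Rightarrow> 'a list set" where
  "lba_language M =
     {w. \<exists>q tp h. (lba_step M)\<^sup>*\<^sup>* (lba_initial M w) (q, tp, h) \<and> q \<in> lba_accepting M}"

text \<open>Every computation, accepting or not, on every input \<open>w\<close> has at most \<open>T (length w)\<close> steps.\<close>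

definition lba_runs_in_time :: "('q, 'a, 'g) lba \<Rightarrow> (nat \<Rightarrow> nat) \<Rightarrow> bool" where
  "lba_runs_in_time M T \<longleftrightarrow>
     (\<forall>w n c. (lba_step M ^^ n) (lba_initial M w) c \<longrightarrow> n \<le> T (length w))"

end

theory Submission
  imports Defs
begin

text \<open>
  The bijection holds because decoding is reversible. Cut a codeword into blocks \<open>t\<^sup>s x\<close> with
  \<open>x\<close> one of \<open>l, r, m, f\<close>. A block replaces one slot of the current partial permutation by the next
  number \<open>i\<close>, possibly with a slot on either side of it. No two slots are ever adjacent, so the result
  determines the block: the slots touching \<open>i\<close> are the ones that the block created, which gives \<open>x\<close>;
  merging them with \<open>i\<close> back into one slot gives the previous state, and the number of slots to
  the left of that one is \<open>s\<close>. Undoing blocks one after the other shows that the map is injective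
  (\<open>builds_unique\<close>), and removing the largest entry of a permutation again and again produces a codeword
  for it (\<open>builds_exists\<close>).

  For the automaton, an occurrence of a pattern of length \<open>k\<close> in the decoded permutation amounts to \<open>k\<close>
  positions in the codeword, since every letter other than \<open>t\<close> stands for one entry. The order of the
  values is the order of these positions. The left-to-right order of the entries can be computed in a
  single pass over the codeword with one counter per chosen letter: the number of open slots to the left
  of its entry. A block \<open>t\<^sup>s x\<close> acts to the right of an entry if and only if that counter is at most
  \<open>s\<close>, and this comparison tells both where a new entry is relative to the old ones and how the counter
  changes (\<open>scan_inv_insert\<close>). There are polynomially many choices of \<open>k\<close> positions, so trying all of them
  takes polynomial time and needs only \<open>O(k)\<close> numbers bounded by the length of the input.

  Such a computation is first expressed on a register machine, whose registers hold numbers between 0 and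
  the length \<open>n\<close> of the input, with a step that reads the letters at the registers and compares the registers.
  A machine deciding a property of a tuple of numbers yields one deciding that all tuples have it:
  on success, advance a register and start over (\<open>forall_machine_decides\<close>). A register of value \<open>v\<close> is kept
  on the tape in unary, as a mark on the first \<open>v\<close> cells. One step of the register machine then
  amounts to a sweep of the head to the right, collecting letters and comparisons, and a sweep back to the left,
  rewriting the marks (\<open>reg_halts_sweeps\<close>). A machine that only sweeps is a deterministic linear-bounded
  automaton with \<open>2n + 2\<close> steps for each pair of sweeps (\<open>lba_exists\<close>).
\<close>

section \<open>Decoding block by block\<close>

text \<open>
  The slots that a letter leaves on either side of the inserted entry. These two lists determine a letter
  other than \<open>t\<close>, which is what makes a block recoverable from its result.
\<close>

definition left_slots :: "it_letter \<Rightarrow> real option list" where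
  "left_slots x = (if x = Lr \<or> x = Lm then [None] else [])"

definition right_slots :: "it_letter \<Rightarrow> real option list" where
  "right_slots x = (if x = Ll \<or> x = Lm then [None] else [])"

definition block :: "it_letter \<Rightarrow> nat \<Rightarrow> real option list" where
  "block x i = left_slots x @ Some (real i) # right_slots x"

text \<open>
  The prefixes of codewords that end after a complete block, with the partial permutation that they
  decode to and the next number to insert. After a complete block the next slot is the first one again, so
  the number of translations in a block is the number of slots to the left of the one that it fills.
\<close>

inductive builds :: "it_letter list \<Rightarrow> real option list \<Rightarrow> nat \<Rightarrow> bool" where
  init: "builds [] [None] 1"
| insert: "builds u (A @ None # B) i \<Longrightarrow> x \<noteq> Lt \<Longrightarrow>
    builds (u @ replicate (count_list A None) Lt @ [x]) (A @ block x i @ B) (Suc i)"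

lemma replace_slot_append:
  "replace_slot (Suc (count_list A None)) b (A @ None # B) = A @ b @ B"
proof (induction A)
  case (Cons y A)
  then show ?case by (cases y) auto
qed simp

lemma fold_translate: "fold it_step (replicate k Lt) (P, i, s) = (P, i, s + k)"
  by (induction k arbitrary: s) auto

lemma it_step_insert:
  assumes "x \<noteq> Lt"
  shows "it_step x (A @ None # B, i, Suc (count_list A None)) = (A @ block x i @ B, Suc i, 1)"
  using assms replace_slot_append[of A "block x i" B]
  by (cases x) (auto simp: block_def left_slots_def right_slots_def)

lemma builds_decodes: "builds u P i \<Longrightarrow> fold it_step u ([None], 1, 1) = (P, i, 1)"
proof (induction rule: builds.induct)
  case (insert u A B i x)
  have "fold it_step (replicate (count_list A None) Lt @ [x]) (A @ None # B, i, 1) =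
      it_step x (fold it_step (replicate (count_list A None) Lt) (A @ None # B, i, 1))"
    by (simp del: it_step.simps)
  also have "\<dots> = (A @ block x i @ B, Suc i, 1)"
    unfolding fold_translate using it_step_insert[OF insert.hyps(2)] by simp
  finally show ?case unfolding fold_append comp_def insert.IH .
qed simp

lemma count_list_replicate: "count_list (replicate k x) y = (if x = y then k else 0)"
  by (induction k) auto

lemma count_slots_block:
  "x \<noteq> Lt \<Longrightarrow> count_list (block x i) None + (if x = Lf then 1 else 0) = 1 + (if x = Lm then 1 else 0)"
  by (cases x) (auto simp: block_def left_slots_def right_slots_def)

text \<open>The number of open slots is always one more than this number.\<close>

definition balance :: "it_letter list \<Rightarrow> int" where
  "balance w = int (count_list w Lm) - int (count_list w Lf)"

lemma balance_snoc:
  "balance (w @ [x]) = balance w + (if x = Lm then 1 else 0) - (if x = Lf then 1 else 0)"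
  by (simp add: balance_def)

lemma balance_translate: "balance (w @ replicate k Lt) = balance w"
  by (simp add: balance_def count_list_replicate)

lemma builds_slots: "builds u P i \<Longrightarrow> int (count_list P None) = balance u + 1"
proof (induction rule: builds.induct)
  case (insert u A B i x)
  have "balance (u @ replicate (count_list A None) Lt @ [x]) =
    balance ((u @ replicate (count_list A None) Lt) @ [x])" by simp
  also have "\<dots> = balance u + (if x = Lm then 1 else 0) - (if x = Lf then 1 else 0)"
    unfolding balance_snoc balance_translate ..
  finally show ?case using insert count_slots_block[of x i] by (auto split: if_splits)
qed (simp add: balance_def)

lemma builds_index: "builds u P i \<Longrightarrow> i = Suc (length (filter (\<lambda>x. x \<noteq> Lt) u))"
  by (induction rule: builds.induct) auto

lemma builds_pos: "builds u P i \<Longrightarrow> 0 < i"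
  by (induction rule: builds.induct) auto

lemma filter_block: "filter (\<lambda>y. y \<noteq> None) (block x i) = [Some (real i)]"
  by (simp add: block_def left_slots_def right_slots_def)

lemma builds_entries:
  "builds u P i \<Longrightarrow> set (filter (\<lambda>y. y \<noteq> None) P) = (Some \<circ> real) ` {1..<i}
     \<and> distinct (filter (\<lambda>y. y \<noteq> None) P)"
proof (induction rule: builds.induct)
  case (insert u A B i x)
  let ?f = "filter (\<lambda>y. y \<noteq> (None :: real option))"
  have IH: "set (?f A) \<union> set (?f B) = (Some \<circ> real) ` {1..<i}" "distinct (?f A @ ?f B)"
    using insert.IH by auto
  have new: "Some (real i) \<notin> set (?f A) \<union> set (?f B)"
    unfolding IH by auto
  have "{1..<Suc i} = insert i {1..<i}"
    using builds_pos[OF insert.hyps(1)] by auto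
  then have "set (?f (A @ block x i @ B)) = (Some \<circ> real) ` {1..<Suc i}"
    unfolding filter_append filter_block set_append using IH(1) by auto
  moreover have "distinct (?f (A @ block x i @ B))"
    unfolding filter_append filter_block using IH(2) new by auto
  ultimately show ?case by blast
qed auto

text \<open>
  Adjacent slots would make decoding ambiguous: the same entry could be inserted into either of them.
  They never arise, because a block puts its entry between the two slots that it creates.
\<close>

abbreviation separated :: "real option list \<Rightarrow> bool" where
  "separated \<equiv> successively (\<lambda>x y. x \<noteq> None \<or> y \<noteq> None)"

lemma separated_slot:
  "separated (A @ None # B) \<longleftrightarrow>
     separated A \<and> separated B \<and> (A = [] \<or> last A \<noteq> None) \<and> (B = [] \<or> hd B \<noteq> None)"
  by (cases B) (auto simp: successively_append_iff)

lemma separated_block: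
  "separated (A @ None # B) \<Longrightarrow> separated (A @ block x i @ B)"
  unfolding separated_slot block_def left_slots_def right_slots_def
  by (cases B) (auto simp: successively_append_iff)

lemma builds_separated: "builds u P i \<Longrightarrow> separated P"
proof (induction rule: builds.induct)
  case (insert u A B i x)
  show ?case by (rule separated_block[OF insert.IH])
qed simp

lemma builds_nonempty: "builds u P i \<Longrightarrow> P \<noteq> []"
  by (induction rule: builds.induct) (auto simp: block_def)

lemma left_slots_cancel:
  assumes "A = [] \<or> last A \<noteq> None" "A' = [] \<or> last A' \<noteq> None"
    and "A @ left_slots x = A' @ left_slots x'"
  shows "A = A' \<and> left_slots x = left_slots x'"
  using assms by (auto simp: left_slots_def split: if_splits)

lemma right_slots_cancel:
  assumes "B = [] \<or> hd B \<noteq> None" "B' = [] \<or> hd B' \<noteq> None"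
    and "right_slots x @ B = right_slots x' @ B'"
  shows "B = B' \<and> right_slots x = right_slots x'"
  using assms by (auto simp: right_slots_def split: if_splits)

lemma letter_eqI:
  "x \<noteq> Lt \<Longrightarrow> x' \<noteq> Lt \<Longrightarrow> left_slots x = left_slots x' \<Longrightarrow> right_slots x = right_slots x' \<Longrightarrow> x = x'"
  by (cases x; cases x') (auto simp: left_slots_def right_slots_def)

lemma append_Cons_unique:
  assumes "A @ z # B = A' @ z # B'" "z \<notin> set A" "z \<notin> set A'"
  shows "A = A' \<and> B = B'"
  using assms
proof (induction A arbitrary: A')
  case Nil
  then show ?case by (cases A') auto
next
  case (Cons y A)
  then show ?case by (cases A') auto
qed

text \<open>
  A block can be read off its result. In the result, the slots touching the new entry are the ones
  created with it: the slot that it replaced had no slot next to it.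
\<close>

lemma insertion_unique:
  assumes "separated (A @ None # B)" "separated (A' @ None # B')"
    and "Some (real i) \<notin> set (A @ B)" "Some (real i) \<notin> set (A' @ B')"
    and "x \<noteq> Lt" "x' \<noteq> Lt" and eq: "A @ block x i @ B = A' @ block x' i @ B'"
  shows "A = A' \<and> B = B' \<and> x = x'"
proof -
  have e: "(A @ left_slots x) @ Some (real i) # right_slots x @ B =
        (A' @ left_slots x') @ Some (real i) # right_slots x' @ B'"
    using eq by (simp add: block_def)
  have n: "Some (real i) \<notin> set (A @ left_slots x)" "Some (real i) \<notin> set (A' @ left_slots x')"
    using assms(3,4) by (simp_all add: left_slots_def)
  have *: "A @ left_slots x = A' @ left_slots x'" "right_slots x @ B = right_slots x' @ B'"
    using append_Cons_unique[OF e n] by (rule conjunct1, rule conjunct2)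
  have "A = A' \<and> left_slots x = left_slots x'"
    by (rule left_slots_cancel[OF _ _ *(1)]) (use iffD1[OF separated_slot assms(1)] iffD1[OF separated_slot assms(2)] in blast)+
  moreover have "B = B' \<and> right_slots x = right_slots x'"
    by (rule right_slots_cancel[OF _ _ *(2)]) (use iffD1[OF separated_slot assms(1)] iffD1[OF separated_slot assms(2)] in blast)+
  ultimately show ?thesis using letter_eqI[OF assms(5,6)] by blast
qed

lemma builds_fresh:
  assumes "builds u P i" shows "Some (real i) \<notin> set P"
proof
  assume "Some (real i) \<in> set P"
  then have "Some (real i) \<in> set (filter (\<lambda>y. y \<noteq> None) P)" by simp
  then have "Some (real i) \<in> (Some \<circ> real) ` {1..<i}" using builds_entries[OF assms] by blast
  then show False by auto
qed

lemma builds_unique: "builds u P i \<Longrightarrow> builds u' P i \<Longrightarrow> u = u'"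
proof (induction arbitrary: u' rule: builds.induct)
  case init
  then show ?case
    by (auto elim!: builds.cases[of u'] dest: builds_pos)
next
  case (insert u A B i x)
  from insert.prems show ?case
  proof (cases rule: builds.cases)
    case init
    with builds_pos[OF insert.hyps(1)] show ?thesis by simp
  next
    case (insert v A' B' x')
    have b: "builds v (A' @ None # B') i" using insert by simp
    have eq: "A @ block x i @ B = A' @ block x' i @ B'" using insert by simp
    have *: "A = A' \<and> B = B' \<and> x = x'"
      by (rule insertion_unique[OF builds_separated builds_separated _ _ _ _ eq])
        (use b insert builds_fresh[OF b] builds_fresh[OF \<open>builds u (A @ None # B) i\<close>] \<open>x \<noteq> Lt\<close>
          \<open>builds u (A @ None # B) i\<close> in auto)
    then have "u = v" using insert.IH[of v] insert by auto
    then show ?thesis using * insert(1) by simp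
  qed
qed

text \<open>
  Removing the largest entry together with the slots that touch it, and putting one slot in their place,
  undoes a block; this leads down to the single slot that decoding starts with.
\<close>

lemma builds_exists:
  assumes "separated P" "P \<noteq> []" "distinct (filter (\<lambda>y. y \<noteq> None) P)"
    and "set (filter (\<lambda>y. y \<noteq> None) P) = (Some \<circ> real) ` {1..i}"
  shows "\<exists>u. builds u P (Suc i)"
  using assms
proof (induction i arbitrary: P)
  case 0
  then have all: "\<And>y. y \<in> set P \<Longrightarrow> y = None" by auto
  then obtain P' where P: "P = None # P'" using 0 by (cases P) auto
  have "P' = []" using 0(1) all by (cases P') (auto simp: P)
  then show ?case using P builds.init by auto
next
  case (Suc i)
  let ?f = "filter (\<lambda>y. y \<noteq> (None :: real option))"
  let ?z = "Some (real (Suc i))"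
  have "?z \<in> set (?f P)" unfolding Suc.prems(4) by (rule image_eqI[of _ _ "Suc i"]) auto
  then obtain A B where P: "P = A @ ?z # B" by (auto dest: split_list)
  have z: "?z \<notin> set (?f A @ ?f B)" and dist: "distinct (?f A @ ?f B)"
    using Suc.prems(3) unfolding P by auto
  have "set (?f A @ ?f B) = set (?f P) - {?z}" using z unfolding P by auto
  also have "\<dots> = (Some \<circ> real) ` {1..i}"
    unfolding Suc.prems(4) by (simp add: atLeastAtMostSuc_conv) auto
  finally have ent: "set (?f A @ ?f B) = (Some \<circ> real) ` {1..i}" .
  have sep: "separated A" "separated B"
    using Suc.prems(1) unfolding P by (auto simp: successively_append_iff successively_Cons)
  obtain A' a where A: "A = A' @ (if a then [None] else [])" and A': "A' = [] \<or> last A' \<noteq> None"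
  proof (cases "A = [] \<or> last A \<noteq> None")
    case True then show thesis using that[of A False] by simp
  next
    case False
    then obtain A1 where A1: "A = A1 @ [None]" by (cases A rule: rev_cases) auto
    have "A1 = [] \<or> last A1 \<noteq> None" using sep(1) unfolding A1 by (auto simp: successively_append_iff)
    then show thesis using that[of A1 True] A1 by simp
  qed
  obtain B' b where B: "B = (if b then [None] else []) @ B'" and B': "B' = [] \<or> hd B' \<noteq> None"
  proof (cases "B = [] \<or> hd B \<noteq> None")
    case True then show thesis using that[of False B] by simp
  next
    case False
    then obtain B1 where B1: "B = None # B1" by (cases B) auto
    have "B1 = [] \<or> hd B1 \<noteq> None" using sep(2) unfolding B1 by (cases B1) auto
    then show thesis using that[of True B1] B1 by simp
  qed
  define x where "x = (if a then if b then Lm else Lr else if b then Ll else Lf)"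
  have x: "x \<noteq> Lt" "left_slots x = (if a then [None] else [])" "right_slots x = (if b then [None] else [])"
    unfolding x_def left_slots_def right_slots_def by auto
  have Px: "P = A' @ block x (Suc i) @ B'" unfolding P A B block_def x by simp
  have "separated (A' @ None # B')"
    unfolding separated_slot using A' B' sep unfolding A B
    by (auto simp: successively_append_iff successively_Cons split: if_splits)
  moreover have "?f (A' @ None # B') = ?f A @ ?f B" unfolding A B by auto
  ultimately obtain u where "builds u (A' @ None # B') (Suc i)"
    using Suc.IH[of "A' @ None # B'"] dist ent by auto
  then show ?case using builds.insert[OF _ x(1)] Px by blast
qed

section \<open>Codewords and permutations\<close>

text \<open>The bound on the runs of \<open>t\<close> in codewords, which is inherited by prefixes.\<close>

definition admissible :: "it_letter list \<Rightarrow> bool" where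
  "admissible w \<longleftrightarrow>
     (\<forall>i < length w. w ! i \<noteq> Lt \<longrightarrow> int (trailing_ts (take i w)) \<le> balance (take i w))"

lemma admissible_Nil: "admissible []"
  by (simp add: admissible_def)

lemma admissible_snoc:
  "admissible (w @ [x]) \<longleftrightarrow> admissible w \<and> (x \<noteq> Lt \<longrightarrow> int (trailing_ts w) \<le> balance w)"
  unfolding admissible_def by (auto simp: nth_append less_Suc_eq)

lemma trailing_ts_Nil: "trailing_ts [] = 0"
  by (simp add: trailing_ts_def)

lemma trailing_ts_snoc: "trailing_ts (w @ [x]) = (if x = Lt then Suc (trailing_ts w) else 0)"
  by (simp add: trailing_ts_def)

lemma it_codewords_eq:
  "it_codewords = {w. admissible w \<and> w \<noteq> [] \<and> last w = Lf \<and> balance w = - 1}"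
  unfolding it_codewords_def admissible_def balance_def by auto

lemma split_at_slot:
  "s < count_list P None \<Longrightarrow> \<exists>A B. P = A @ None # B \<and> count_list A None = s"
proof (induction P arbitrary: s)
  case (Cons y P)
  show ?case
  proof (cases "y = None \<and> s = 0")
    case True
    then show ?thesis by (intro exI[of _ "[]"] exI[of _ P]) simp
  next
    case False
    then have "s - (if y = None then 1 else 0) < count_list P None" using Cons.prems by auto
    from Cons.IH[OF this] obtain A B
      where "P = A @ None # B" "count_list A None = s - (if y = None then 1 else 0)" by blast
    then show ?thesis using False by (intro exI[of _ "y # A"] exI[of _ B]) auto
  qed
qed simp

text \<open>
  The bound on the runs of \<open>t\<close> says exactly that the slot addressed by a block exists, as there is one slot
  more than the balance.
\<close>

lemma admissible_builds:
  "admissible w \<Longrightarrow> \<exists>u P i. w = u @ replicate (trailing_ts w) Lt \<and> builds u P i"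
proof (induction w rule: rev_induct)
  case Nil
  then show ?case using builds.init by (auto simp: trailing_ts_Nil)
next
  case (snoc x w)
  then obtain u P i where w: "w = u @ replicate (trailing_ts w) Lt" and b: "builds u P i"
    by (auto simp: admissible_snoc)
  show ?case
  proof (cases "x = Lt")
    case True
    then show ?thesis using w b
      by (intro exI[of _ u] exI[of _ P] exI[of _ i])
        (metis append_assoc replicate_Suc replicate_append_same trailing_ts_snoc)
  next
    case False
    then have "int (trailing_ts w) \<le> balance u"
      using snoc.prems w by (metis admissible_snoc balance_translate)
    then have "trailing_ts w < count_list P None" using builds_slots[OF b] by linarith
    then obtain A B where "P = A @ None # B" "count_list A None = trailing_ts w"
      using split_at_slot by blast
    then have "builds (w @ [x]) (A @ block x i @ B) (Suc i)"
      using builds.insert[of u A B i x] b False w by (metis append_assoc)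
    then show ?thesis using False by (auto simp: trailing_ts_snoc)
  qed
qed

lemma trailing_ts_builds: "builds u P i \<Longrightarrow> trailing_ts u = 0"
  by (induction rule: builds.induct) (auto simp: trailing_ts_def)

lemma trailing_ts_translate: "trailing_ts (u @ replicate k Lt) = trailing_ts u + k"
proof (induction k)
  case (Suc k)
  have "u @ replicate (Suc k) Lt = (u @ replicate k Lt) @ [Lt]"
    by (simp add: replicate_append_same)
  then show ?case using Suc by (simp only: trailing_ts_snoc) simp
qed simp

lemma admissible_translate: "admissible (u @ replicate k Lt) \<longleftrightarrow> admissible u"
proof (induction k)
  case (Suc k)
  have "u @ replicate (Suc k) Lt = (u @ replicate k Lt) @ [Lt]"
    by (simp add: replicate_append_same)
  then show ?case using Suc by (simp only: admissible_snoc) simp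
qed simp

lemma builds_admissible: "builds u P i \<Longrightarrow> admissible u"
proof (induction rule: builds.induct)
  case (insert u A B i x)
  let ?v = "u @ replicate (count_list A None) Lt"
  have "int (trailing_ts ?v) \<le> balance ?v"
    using builds_slots[OF insert.hyps(1)] trailing_ts_builds[OF insert.hyps(1)]
    by (simp add: trailing_ts_translate balance_translate)
  then have "admissible (?v @ [x])"
    using insert.IH by (simp only: admissible_snoc admissible_translate) simp
  then show ?case by simp
qed (simp add: admissible_Nil)

lemma codeword_builds:
  assumes "w \<in> it_codewords"
  obtains i where "builds w (map Some (it_perm w)) (Suc i)" "1 \<le> i" "i = card (set (it_perm w))"
proof -
  have w: "admissible w" "w \<noteq> []" "last w = Lf" "balance w = - 1"
    using assms by (auto simp: it_codewords_eq)
  obtain u P i where u: "w = u @ replicate (trailing_ts w) Lt" "builds u P i"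
    using admissible_builds[OF w(1)] by blast
  have "trailing_ts w = 0" using w(2,3) by (cases w rule: rev_cases) (auto simp: trailing_ts_snoc)
  with u have b: "builds w P i" by simp
  have "None \<notin> set P" using builds_slots[OF b] w(4) by (simp add: count_list_0_iff)
  then have P: "map (Some \<circ> the) P = P"
    by (intro map_idI) (metis comp_apply option.collapse)
  have p: "it_perm w = map the P" unfolding it_perm_def builds_decodes[OF b] by simp
  have b': "builds w (map Some (it_perm w)) i" using b P by (simp add: p)
  obtain j where j: "i = Suc j" using builds_pos[OF b] by (cases i) auto
  have "filter (\<lambda>y. y \<noteq> None) (map Some (it_perm w)) = map Some (it_perm w)"
    by (simp add: filter_id_conv)
  then have "Some ` set (it_perm w) = Some ` real ` {1..j}"
    using builds_entries[OF b'] unfolding j by (simp add: image_comp atLeastLessThanSuc_atLeastAtMost)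
  then have S: "set (it_perm w) = real ` {1..j}" by (simp add: inj_image_eq_iff)
  then have c: "card (set (it_perm w)) = j" by (simp add: card_image)
  have "it_perm w \<noteq> []" using builds_nonempty[OF b'] by simp
  then have "1 \<le> j" using S by (cases j) simp_all
  then show thesis by (rule that[rotated]) (simp_all only: b' c j[symmetric])
qed

lemma builds_perms_of:
  assumes "builds w (map Some p) (Suc n)"
  shows "p \<in> perms_of n"
proof -
  have f: "filter (\<lambda>y. y \<noteq> None) (map Some p) = map Some p" by (simp add: filter_id_conv)
  have "Some ` set p = Some ` real ` {1..n}" "distinct p"
    using builds_entries[OF assms] unfolding f
    by (auto simp: image_comp atLeastLessThanSuc_atLeastAtMost distinct_map)
  then show ?thesis by (simp add: perms_of_def is_perm_def inj_image_eq_iff)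
qed

lemma perms_of_builds:
  assumes "p \<in> perms_of n" "1 \<le> n"
  obtains w where "builds w (map Some p) (Suc n)"
proof -
  have f: "filter (\<lambda>y. y \<noteq> None) (map Some p) = map Some p" by (simp add: filter_id_conv)
  have p: "distinct p" "set p = real ` {1..n}" using assms by (auto simp: perms_of_def is_perm_def)
  have "separated (map Some p)" by (simp add: successively_map successively_if_sorted_wrt sorted_wrt_true)
  moreover have "map Some p \<noteq> []" using p(2) assms(2) by auto
  moreover have "set (map Some p) = (Some \<circ> real) ` {1..n}" using p(2) by (simp add: image_comp)
  ultimately show thesis using builds_exists[of "map Some p" n] p(1) that unfolding f
    by (auto simp: distinct_map)
qed

lemma builds_codeword:
  assumes "builds w (map Some p) i"
  shows "w \<in> it_codewords" and "it_perm w = p"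
proof -
  have "count_list (map Some p) None = 0" by (auto simp: count_list_0_iff)
  then have bal: "balance w = - 1" using builds_slots[OF assms] by simp
  have "w \<noteq> [] \<and> last w = Lf" using assms
  proof (cases rule: builds.cases)
    case (insert u A B j x)
    have "None \<notin> set (block x j)" using insert(2) by (metis Un_iff ex_map_conv option.distinct(1) set_append)
    then have "x = Lf" using insert(5) by (cases x) (auto simp: block_def left_slots_def right_slots_def)
    then show ?thesis using insert by simp
  qed auto
  then show "w \<in> it_codewords" using bal builds_admissible[OF assms] by (simp add: it_codewords_eq)
  show "it_perm w = p" unfolding it_perm_def builds_decodes[OF assms] by (simp add: comp_def)
qed

lemma bij_betw_it_perm: "bij_betw it_perm it_codewords (\<Union>n \<in> {1..}. perms_of n)"
proof (rule bij_betw_imageI)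
  show "inj_on it_perm it_codewords"
  proof (rule inj_onI)
    fix w w' assume w: "w \<in> it_codewords" "w' \<in> it_codewords" and eq: "it_perm w = it_perm w'"
    show "w = w'"
      by (rule codeword_builds[OF w(1)], rule codeword_builds[OF w(2)])
        (use eq builds_unique in auto)
  qed
next
  show "it_perm ` it_codewords = (\<Union>n \<in> {1..}. perms_of n)"
  proof (intro equalityI subsetI)
    fix p assume "p \<in> it_perm ` it_codewords"
    then show "p \<in> (\<Union>n \<in> {1..}. perms_of n)"
      by (auto elim!: codeword_builds intro: builds_perms_of)
  next
    fix p assume "p \<in> (\<Union>n \<in> {1..}. perms_of n)"
    then obtain n where "1 \<le> n" "p \<in> perms_of n" by auto
    then obtain w where "builds w (map Some p) (Suc n)" using perms_of_builds by blast
    then show "p \<in> it_perm ` it_codewords" by (metis builds_codeword image_eqI)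
  qed
qed

text \<open>Avoidance is a property of the decoded permutation, so it cuts out corresponding subsets on both sides.\<close>

lemma bij_betw_it_perm_restrict:
  "bij_betw it_perm {w \<in> it_codewords. \<Phi> (it_perm w)} (\<Union>n \<in> {1..}. {p \<in> perms_of n. \<Phi> p})"
proof -
  have "(\<Union>n \<in> {1..}. {p \<in> perms_of n. \<Phi> p}) = {p \<in> (\<Union>n \<in> {1..}. perms_of n). \<Phi> p}" by auto
  also have "\<dots> = it_perm ` {w \<in> it_codewords. \<Phi> (it_perm w)}"
    using bij_betw_it_perm unfolding bij_betw_def by auto
  finally show ?thesis
    using bij_betw_it_perm by (auto simp: bij_betw_def intro: inj_on_subset)
qed


section \<open>Linear-bounded automata up to renaming\<close>

text \<open>
  States and auxiliary symbols are structured objects in what follows. As there are finitely many of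
  them, they can be replaced by natural numbers in the end.
\<close>

definition rename_lba :: "('q \<Rightarrow> 'p) \<Rightarrow> ('g \<Rightarrow> 'h) \<Rightarrow> ('q, 'a, 'g) lba \<Rightarrow> ('p, 'a, 'h) lba" where
  "rename_lba f g M =
     \<lparr>lba_states = f ` lba_states M, lba_aux = g ` lba_aux M, lba_start = f (lba_start M),
      lba_accepting = f ` lba_accepting M,
      lba_trans = (\<lambda>(q, a, q', b, d).
        (f q, map_tape_symbol id g a, f q', map_tape_symbol id g b, d)) ` lba_trans M\<rparr>"

lemma tape_alphabet_rename:
  "tape_alphabet (rename_lba f g M) = map_tape_symbol id g ` tape_alphabet M"
  by (simp add: tape_alphabet_def rename_lba_def image_Un image_image)

lemma map_tape_symbol_ends:
  "map_tape_symbol id g a = LeftEnd \<longleftrightarrow> a = LeftEnd"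
  "map_tape_symbol id g a = RightEnd \<longleftrightarrow> a = RightEnd"
  by (cases a; simp)+

lemma is_lba_rename:
  assumes "is_lba M" shows "is_lba (rename_lba f g M)"
  using assms unfolding is_lba_def tape_alphabet_rename
  by (auto simp: rename_lba_def map_tape_symbol_ends; force)

lemma inj_on_map_tape_symbol:
  assumes "inj_on g (lba_aux M)"
  shows "inj_on (map_tape_symbol id g) (tape_alphabet M)"
  using assms by (auto simp: inj_on_def tape_alphabet_def)

text \<open>
  The renaming is injective on the states and symbols of the automaton only, so a step of the renamed
  automaton can be traced back only from a configuration made of them.
\<close>

definition well_formed_config :: "('q, 'a, 'g) lba \<Rightarrow> ('q, 'a, 'g) lba_config \<Rightarrow> bool" where
  "well_formed_config M c \<longleftrightarrow> fst c \<in> lba_states M \<and> set (fst (snd c)) \<subseteq> tape_alphabet M"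

lemma well_formed_initial: "is_lba M \<Longrightarrow> well_formed_config M (lba_initial M w)"
  by (auto simp: well_formed_config_def lba_initial_def is_lba_def tape_alphabet_def)

lemma well_formed_step:
  assumes "is_lba M" "lba_step M c c'" "well_formed_config M c"
  shows "well_formed_config M c'"
  using assms(2,3,1)
proof cases
  case (1 h tp q q' b d)
  then have "q' \<in> lba_states M" "b \<in> tape_alphabet M"
    using assms(1) by (auto simp: is_lba_def)
  then show ?thesis
    using 1 assms(3) set_update_subset_insert[of tp h b] by (auto simp: well_formed_config_def)
qed

definition rename_config ::
  "('q \<Rightarrow> 'p) \<Rightarrow> ('g \<Rightarrow> 'h) \<Rightarrow> ('q, 'a, 'g) lba_config \<Rightarrow> ('p, 'a, 'h) lba_config" where
  "rename_config f g = (\<lambda>(q, tp, h). (f q, map (map_tape_symbol id g) tp, h))"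

lemma rename_initial: "lba_initial (rename_lba f g M) w = rename_config f g (lba_initial M w)"
  by (simp add: lba_initial_def rename_lba_def rename_config_def)

lemma step_rename:
  assumes "lba_step M c c'"
  shows "lba_step (rename_lba f g M) (rename_config f g c) (rename_config f g c')"
  using assms
proof cases
  case (1 h tp q q' b d)
  have "(f q, map_tape_symbol id g (tp ! h), f q', map_tape_symbol id g b, d)
      \<in> lba_trans (rename_lba f g M)"
    using 1 by (force simp: rename_lba_def)
  then show ?thesis
    using lba_step.intros[of h "map (map_tape_symbol id g) tp" "f q" "f q'" "map_tape_symbol id g b" d]
    by (simp add: 1 rename_config_def map_update)
qed

lemma step_rename_reflect:
  assumes M: "is_lba M" and inj: "inj_on f (lba_states M)" "inj_on g (lba_aux M)"
    and wf: "well_formed_config M c"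
    and step: "lba_step (rename_lba f g M) (rename_config f g c) e"
  obtains c' where "lba_step M c c'" "e = rename_config f g c'"
proof -
  obtain q tp h where c: "c = (q, tp, h)" by (cases c)
  from step obtain p b d where h: "h < length tp"
    and tr: "(f q, map_tape_symbol id g (tp ! h), p, b, d) \<in> lba_trans (rename_lba f g M)"
    and e: "e = (p, (map (map_tape_symbol id g) tp)[h := b], move_head d h)"
    unfolding c rename_config_def by (auto elim!: lba_step.cases)
  from tr obtain q1 a q' b1 where t: "(q1, a, q', b1, d) \<in> lba_trans M"
    and eq: "f q1 = f q" "map_tape_symbol id g a = map_tape_symbol id g (tp ! h)"
      "p = f q'" "b = map_tape_symbol id g b1"
    by (force simp: rename_lba_def)
  have "q1 \<in> lba_states M" "a \<in> tape_alphabet M" using t M by (auto simp: is_lba_def)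
  moreover have "q \<in> lba_states M" "tp ! h \<in> tape_alphabet M"
    using wf h by (auto simp: c well_formed_config_def)
  ultimately have "q1 = q" "a = tp ! h"
    using eq(1,2) inj(1) inj_on_map_tape_symbol[OF inj(2)] by (auto dest: inj_onD)
  then have "lba_step M c (q', tp[h := b1], move_head d h)"
    unfolding c using t h by (auto intro: lba_step.intros)
  then show thesis using that by (simp add: e eq rename_config_def map_update)
qed

lemma well_formed_steps:
  assumes "is_lba M" "(lba_step M ^^ n) c c'" "well_formed_config M c"
  shows "well_formed_config M c'"
  using assms(2)
proof (induction n arbitrary: c')
  case (Suc n)
  from Suc.prems obtain c1 where "(lba_step M ^^ n) c c1" "lba_step M c1 c'"
    by (blast elim: relpowp_Suc_E)
  then show ?case using well_formed_step[OF assms(1)] Suc.IH by blast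
qed (use assms(3) in simp)

lemma steps_rename_iff:
  assumes M: "is_lba M" and inj: "inj_on f (lba_states M)" "inj_on g (lba_aux M)"
    and wf: "well_formed_config M c"
  shows "(lba_step (rename_lba f g M) ^^ n) (rename_config f g c) e \<longleftrightarrow>
    (\<exists>c'. (lba_step M ^^ n) c c' \<and> e = rename_config f g c')"
proof (induction n arbitrary: e)
  case 0
  then show ?case by auto
next
  case (Suc n)
  show ?case
  proof
    assume "(lba_step (rename_lba f g M) ^^ Suc n) (rename_config f g c) e"
    then obtain c' where c': "(lba_step M ^^ n) c c'"
      and "lba_step (rename_lba f g M) (rename_config f g c') e"
      using Suc by (auto elim!: relcomppE)
    then obtain c'' where "lba_step M c' c''" "e = rename_config f g c''"
      using step_rename_reflect[OF M inj well_formed_steps[OF M c' wf]] by blast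
    then show "\<exists>c'. (lba_step M ^^ Suc n) c c' \<and> e = rename_config f g c'"
      using c' by (blast intro: relpowp_Suc_I)
  next
    assume "\<exists>c'. (lba_step M ^^ Suc n) c c' \<and> e = rename_config f g c'"
    then obtain c1 c' where "(lba_step M ^^ n) c c1" "lba_step M c1 c'" "e = rename_config f g c'"
      by (auto elim!: relcomppE)
    then show "(lba_step (rename_lba f g M) ^^ Suc n) (rename_config f g c) e"
      using Suc step_rename by (blast intro: relpowp_Suc_I)
  qed
qed

lemma lba_language_iff:
  "w \<in> lba_language M \<longleftrightarrow> (\<exists>n c. (lba_step M ^^ n) (lba_initial M w) c \<and> fst c \<in> lba_accepting M)"
  unfolding lba_language_def rtranclp_power by auto

lemma lba_over_nat:
  fixes M :: "('q, 'a, 'g) lba"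
  assumes M: "is_lba M" and T: "lba_runs_in_time M T"
  shows "\<exists>M' :: (nat, 'a, nat) lba. is_lba M' \<and> lba_language M' = lba_language M \<and> lba_runs_in_time M' T"
proof -
  have "finite (Aux ` lba_aux M :: ('a, 'g) tape_symbol set)"
    using M by (simp add: is_lba_def tape_alphabet_def)
  then have "finite (lba_aux M)" by (rule finite_imageD) (simp add: inj_on_def)
  then obtain g :: "'g \<Rightarrow> nat" where g: "inj_on g (lba_aux M)"
    using finite_imp_inj_to_nat_seg by metis
  have "finite (lba_states M)" using M by (simp add: is_lba_def)
  then obtain f :: "'q \<Rightarrow> nat" where f: "inj_on f (lba_states M)"
    using finite_imp_inj_to_nat_seg by metis
  let ?M = "rename_lba f g M"
  note steps = steps_rename_iff[OF M f g well_formed_initial[OF M], folded rename_initial]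
  have acc: "fst (rename_config f g c) \<in> lba_accepting ?M \<longleftrightarrow> fst c \<in> lba_accepting M"
    if c: "(lba_step M ^^ n) (lba_initial M w) c" for n w c
  proof -
    have "fst c \<in> lba_states M"
      using well_formed_steps[OF M c well_formed_initial[OF M]] by (simp add: well_formed_config_def)
    moreover have "lba_accepting M \<subseteq> lba_states M" using M by (simp add: is_lba_def)
    ultimately have "f (fst c) \<in> f ` lba_accepting M \<longleftrightarrow> fst c \<in> lba_accepting M"
      by (rule inj_on_image_mem_iff[OF f])
    then show ?thesis by (cases c) (simp add: rename_config_def rename_lba_def)
  qed
  have "lba_language ?M = lba_language M"
  proof (intro set_eqI iffI)
    fix w assume "w \<in> lba_language ?M"
    then obtain n e where "(lba_step ?M ^^ n) (lba_initial ?M w) e" "fst e \<in> lba_accepting ?M"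
      unfolding lba_language_iff by blast
    then show "w \<in> lba_language M" unfolding lba_language_iff steps using acc by metis
  next
    fix w assume "w \<in> lba_language M"
    then obtain n c where "(lba_step M ^^ n) (lba_initial M w) c" "fst c \<in> lba_accepting M"
      unfolding lba_language_iff by blast
    then show "w \<in> lba_language ?M" unfolding lba_language_iff steps using acc by metis
  qed
  moreover have "lba_runs_in_time ?M T"
    using T unfolding lba_runs_in_time_def steps by metis
  ultimately show ?thesis using is_lba_rename[OF M] by blast
qed


section \<open>Deterministic computations\<close>

lemma deterministic_relpowp:
  fixes R :: "'c \<Rightarrow> 'c \<Rightarrow> bool"
  assumes det: "\<And>x y z. R x y \<Longrightarrow> R x z \<Longrightarrow> y = z"
    and "(R ^^ n) x y" "(R ^^ n) x z"
  shows "y = z"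
  using assms(2,3)
proof (induction n arbitrary: y z)
  case (Suc n)
  obtain y' z' where "(R ^^ n) x y'" "R y' y" "(R ^^ n) x z'" "R z' z"
    using Suc.prems by (blast elim: relpowp_Suc_E)
  then show ?case using Suc.IH det by blast
qed simp

text \<open>
  A deterministic automaton has a single computation on each input. One halting run therefore bounds the
  length of every computation, as the time bound demands, and also decides acceptance.
\<close>

lemma deterministic_halts:
  assumes det: "\<And>x y z. R x y \<Longrightarrow> R x z \<Longrightarrow> y = z"
    and run: "(R ^^ N) x y" and halt: "\<And>z. \<not> R y z"
    and other: "(R ^^ n) x c"
  shows "n \<le> N" and "(\<And>z. \<not> R c z) \<Longrightarrow> c = y"
proof -
  have unique: "e = e'" if "(R ^^ k) x e" "(R ^^ k) x e'" for k e e'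
    by (rule deterministic_relpowp[of R]) (use det that in blast)+
  have stuck: "m = 0" if "(R ^^ m) e e'" "\<And>z. \<not> R e z" for m e e'
    using that by (cases m) (auto elim: relpowp_Suc_E2 simp del: relpowp.simps)
  show le: "n \<le> N"
  proof (rule ccontr)
    assume "\<not> n \<le> N"
    then obtain m where m: "n = N + Suc m" using less_imp_Suc_add[of N n] by auto
    then obtain e where "(R ^^ N) x e" "(R ^^ Suc m) e c"
      using other unfolding m relpowp_add by blast
    then have "(R ^^ Suc m) y c" using unique[OF run] by blast
    then show False using stuck halt by blast
  qed
  assume end_c: "\<And>z. \<not> R c z"
  obtain m where m: "N = n + m" using le le_Suc_ex by blast
  then obtain e where "(R ^^ n) x e" "(R ^^ m) e y"
    using run unfolding m relpowp_add by blast
  then have "(R ^^ m) c y" using unique[OF other] by blast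
  then show "c = y" using stuck end_c by fastforce
qed


section \<open>Sweeping machines\<close>

text \<open>
  A pass of the head over the tape that rewrites every cell, controlled by a finite state. A pass from right to
  left is the same on the reversed tape.
\<close>

primrec sweep :: "('s \<Rightarrow> 'g \<Rightarrow> 's \<times> 'g) \<Rightarrow> 's \<Rightarrow> 'g list \<Rightarrow> 's \<times> 'g list" where
  "sweep \<delta> s [] = (s, [])"
| "sweep \<delta> s (g # gs) =
     (fst (sweep \<delta> (fst (\<delta> s g)) gs), snd (\<delta> s g) # snd (sweep \<delta> (fst (\<delta> s g)) gs))"

lemma length_sweep: "length (snd (sweep \<delta> s gs)) = length gs"
  by (induction gs arbitrary: s) auto

datatype ('s, 'b) sweep_control = Forward 's | Backward 'b | Halted bool

text \<open>
  A cell still holding an input letter is read as its translation, so no separate pass is needed to translate the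
  input. The end-markers are not cells, hence the default.
\<close>

fun read :: "('a \<Rightarrow> 'g) \<Rightarrow> ('a, 'g) tape_symbol \<Rightarrow> 'g" where
  "read ini (Letter a) = ini a"
| "read ini (Aux g) = g"
| "read ini _ = undefined"

text \<open>
  A machine that alternates forward and backward passes. At the right end it chooses between a verdict and
  a backward pass; at the left end it starts the next forward pass. All its parts are functions, so it is deterministic.
\<close>

locale sweep_machine =
  fixes fwd :: "'s \<Rightarrow> 'g \<Rightarrow> 's \<times> 'g" and bwd :: "'b \<Rightarrow> 'g \<Rightarrow> 'b \<times> 'g"
    and turn :: "'s \<Rightarrow> 'b + bool" and again :: "'b \<Rightarrow> 's"
    and ini :: "'a \<Rightarrow> 'g" and s0 :: 's
    and S :: "'s set" and B :: "'b set" and G :: "'g set"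
  assumes finite: "finite S" "finite B" "finite G" "finite (UNIV :: 'a set)"
    and start: "s0 \<in> S" and ini: "ini a \<in> G"
    and fwd: "s \<in> S \<Longrightarrow> g \<in> G \<Longrightarrow> fwd s g \<in> S \<times> G"
    and bwd: "b \<in> B \<Longrightarrow> g \<in> G \<Longrightarrow> bwd b g \<in> B \<times> G"
    and turn: "s \<in> S \<Longrightarrow> turn s = Inl b \<Longrightarrow> b \<in> B"
    and again: "b \<in> B \<Longrightarrow> again b \<in> S"
begin

text \<open>The number counts the pairs of passes before the last forward pass, which gives the verdict.\<close>

inductive halts :: "'s \<Rightarrow> 'g list \<Rightarrow> nat \<Rightarrow> bool \<Rightarrow> bool" where
  verdict: "sweep fwd s gs = (s', gs') \<Longrightarrow> turn s' = Inr v \<Longrightarrow> halts s gs 0 v"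
| cycle: "sweep fwd s gs = (s', gs') \<Longrightarrow> turn s' = Inl b \<Longrightarrow>
    sweep bwd b (rev gs') = (b', gs'') \<Longrightarrow> halts (again b') (rev gs'') N v \<Longrightarrow>
    halts s gs (Suc N) v"

definition cells :: "('a, 'g) tape_symbol set" where
  "cells = range Letter \<union> Aux ` G"

text \<open>There is no transition from \<open>Halted\<close>, so reaching it ends the computation.\<close>

inductive_set transitions ::
  "(('s, 'b) sweep_control \<times> ('a, 'g) tape_symbol \<times> ('s, 'b) sweep_control \<times> ('a, 'g) tape_symbol \<times> move) set"
where
  forward: "s \<in> S \<Longrightarrow> a \<in> cells \<Longrightarrow> fwd s (read ini a) = (s', g) \<Longrightarrow>
    (Forward s, a, Forward s', Aux g, MoveRight) \<in> transitions"
| turn_back: "s \<in> S \<Longrightarrow> turn s = Inl b \<Longrightarrow>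
    (Forward s, RightEnd, Backward b, RightEnd, MoveLeft) \<in> transitions"
| halt: "s \<in> S \<Longrightarrow> turn s = Inr v \<Longrightarrow>
    (Forward s, RightEnd, Halted v, RightEnd, Stay) \<in> transitions"
| backward: "b \<in> B \<Longrightarrow> a \<in> cells \<Longrightarrow> bwd b (read ini a) = (b', g) \<Longrightarrow>
    (Backward b, a, Backward b', Aux g, MoveLeft) \<in> transitions"
| restart: "b \<in> B \<Longrightarrow>
    (Backward b, LeftEnd, Forward (again b), LeftEnd, MoveRight) \<in> transitions"

definition automaton :: "(('s, 'b) sweep_control, 'a, 'g) lba" where
  "automaton = \<lparr>lba_states = Forward ` S \<union> Backward ` B \<union> range Halted, lba_aux = G,
     lba_start = Forward s0, lba_accepting = {Halted True}, lba_trans = transitions\<rparr>"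

lemma read_cells: "a \<in> cells \<Longrightarrow> read ini a \<in> G"
  using ini by (auto simp: cells_def)

lemma is_lba_automaton: "is_lba automaton"
proof -
  have alph: "tape_alphabet automaton = {LeftEnd, RightEnd} \<union> cells"
    by (auto simp: tape_alphabet_def automaton_def cells_def)
  have states: "lba_states automaton = Forward ` S \<union> Backward ` B \<union> range Halted"
    by (simp add: automaton_def)
  have transition: "q \<in> lba_states automaton \<and> q' \<in> lba_states automaton \<and>
      a \<in> tape_alphabet automaton \<and> b \<in> tape_alphabet automaton \<and>
      (a = LeftEnd \<longleftrightarrow> b = LeftEnd) \<and> (a = RightEnd \<longleftrightarrow> b = RightEnd) \<and>
      (a = LeftEnd \<longrightarrow> d \<noteq> MoveLeft) \<and> (a = RightEnd \<longrightarrow> d \<noteq> MoveRight)"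
    if "(q, a, q', b, d) \<in> transitions" for q a q' b d
    using that
  proof cases
    case (forward s s' g)
    then show ?thesis using fwd[of s "read ini a"] read_cells unfolding alph states
      by (auto simp: cells_def)
  next
    case (backward b b' g)
    then show ?thesis using bwd[of b "read ini a"] read_cells unfolding alph states
      by (auto simp: cells_def)
  qed (auto simp: alph states turn again)
  show ?thesis
    unfolding is_lba_def
  proof (intro conjI ballI, goal_cases)
    case (5 t)
    obtain q a q' b d where t: "t = (q, a, q', b, d)" by (rule prod_cases5)
    have "(q, a, q', b, d) \<in> transitions" using 5 by (simp add: t automaton_def)
    then show ?case unfolding t prod.case by (rule transition)
  qed (use finite start in \<open>auto simp: states alph cells_def automaton_def[THEN arg_cong[where f = lba_start]]
      automaton_def[THEN arg_cong[where f = lba_accepting]]\<close>)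
qed

lemma transitions_deterministic:
  assumes "(q, a, q1, b1, d1) \<in> transitions" "(q, a, q2, b2, d2) \<in> transitions"
  shows "q1 = q2 \<and> b1 = b2 \<and> d1 = d2"
  using assms(1)
proof cases
  case (forward s s' g)
  with assms(2) show ?thesis by (auto elim!: transitions.cases simp: cells_def)
next
  case (turn_back s b)
  with assms(2) show ?thesis by (auto elim!: transitions.cases simp: cells_def)
next
  case (halt s v)
  with assms(2) show ?thesis by (auto elim!: transitions.cases simp: cells_def)
next
  case (backward b b' g)
  with assms(2) show ?thesis by (auto elim!: transitions.cases simp: cells_def)
next
  case (restart b)
  with assms(2) show ?thesis by (auto elim!: transitions.cases simp: cells_def)
qed

lemma step_iff:
  "lba_step automaton (q, tp, h) c \<longleftrightarrow>
     h < length tp \<and> (\<exists>q' b d. (q, tp ! h, q', b, d) \<in> transitions \<and> c = (q', tp[h := b], move_head d h))"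
proof
  assume "lba_step automaton (q, tp, h) c"
  then show "h < length tp \<and> (\<exists>q' b d. (q, tp ! h, q', b, d) \<in> transitions \<and> c = (q', tp[h := b], move_head d h))"
    by cases (auto simp: automaton_def)
qed (auto intro: lba_step.intros simp: automaton_def)

lemma step_deterministic:
  "lba_step automaton c c1 \<Longrightarrow> lba_step automaton c c2 \<Longrightarrow> c1 = c2"
  by (cases c) (auto simp: step_iff dest: transitions_deterministic)

lemma halted_stuck: "\<not> lba_step automaton (Halted v, tp, h) c"
  by (auto simp: step_iff elim: transitions.cases)

definition tape :: "('a, 'g) tape_symbol list \<Rightarrow> ('a, 'g) tape_symbol list" where
  "tape ys = LeftEnd # ys @ [RightEnd]"

lemma forward_sweep:
  assumes "s \<in> S" "set ys \<subseteq> cells"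
  shows "(lba_step automaton ^^ length ys) (Forward s, tape (xs @ ys), Suc (length xs))
     (Forward (fst (sweep fwd s (map (read ini) ys))),
      tape (xs @ map Aux (snd (sweep fwd s (map (read ini) ys)))), Suc (length (xs @ ys)))
     \<and> fst (sweep fwd s (map (read ini) ys)) \<in> S \<and> set (snd (sweep fwd s (map (read ini) ys))) \<subseteq> G"
  using assms
proof (induction ys arbitrary: s xs)
  case (Cons y ys)
  obtain s' g where \<delta>: "fwd s (read ini y) = (s', g)" by fastforce
  have y: "y \<in> cells" using Cons.prems by simp
  have s': "s' \<in> S" "g \<in> G" using fwd[of s "read ini y"] Cons.prems(1) read_cells[OF y] \<delta> by auto
  have step: "lba_step automaton (Forward s, tape (xs @ y # ys), Suc (length xs))
      (Forward s', tape ((xs @ [Aux g]) @ ys), Suc (length (xs @ [Aux g])))"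
    unfolding step_iff tape_def using transitions.forward[OF Cons.prems(1) y \<delta>]
    by (intro conjI exI) (auto simp: nth_append list_update_append)
  have run: "(lba_step automaton ^^ length ys)
      (Forward s', tape ((xs @ [Aux g]) @ ys), Suc (length (xs @ [Aux g])))
      (Forward (fst (sweep fwd s' (map (read ini) ys))),
       tape ((xs @ [Aux g]) @ map Aux (snd (sweep fwd s' (map (read ini) ys)))),
       Suc (length ((xs @ [Aux g]) @ ys)))
     \<and> fst (sweep fwd s' (map (read ini) ys)) \<in> S \<and> set (snd (sweep fwd s' (map (read ini) ys))) \<subseteq> G"
    using Cons.prems by (intro Cons.IH s') simp
  show ?case
    using relpowp_Suc_I2[OF step conjunct1[OF run]] conjunct2[OF run] s' by (simp add: \<delta>)
qed simp

lemma backward_sweep: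
  assumes "b \<in> B" "set ys \<subseteq> cells"
  shows "(lba_step automaton ^^ length ys) (Backward b, tape (rev ys @ xs), length ys)
     (Backward (fst (sweep bwd b (map (read ini) ys))),
      tape (rev (map Aux (snd (sweep bwd b (map (read ini) ys)))) @ xs), 0)
     \<and> fst (sweep bwd b (map (read ini) ys)) \<in> B \<and> set (snd (sweep bwd b (map (read ini) ys))) \<subseteq> G"
  using assms
proof (induction ys arbitrary: b xs)
  case (Cons y ys)
  obtain b' g where \<delta>: "bwd b (read ini y) = (b', g)" by fastforce
  have y: "y \<in> cells" using Cons.prems by simp
  have b': "b' \<in> B" "g \<in> G" using bwd[of b "read ini y"] Cons.prems(1) read_cells[OF y] \<delta> by auto
  have step: "lba_step automaton (Backward b, tape (rev (y # ys) @ xs), length (y # ys))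
      (Backward b', tape (rev ys @ Aux g # xs), length ys)"
    unfolding step_iff tape_def using transitions.backward[OF Cons.prems(1) y \<delta>]
    by (intro conjI exI) (auto simp: nth_append list_update_append)
  have run: "(lba_step automaton ^^ length ys)
      (Backward b', tape (rev ys @ Aux g # xs), length ys)
      (Backward (fst (sweep bwd b' (map (read ini) ys))),
       tape (rev (map Aux (snd (sweep bwd b' (map (read ini) ys)))) @ Aux g # xs), 0)
     \<and> fst (sweep bwd b' (map (read ini) ys)) \<in> B \<and> set (snd (sweep bwd b' (map (read ini) ys))) \<subseteq> G"
    using Cons.prems by (intro Cons.IH b') simp
  show ?case
    using relpowp_Suc_I2[OF step conjunct1[OF run]] conjunct2[OF run] b' by (simp add: \<delta>)
qed simp

lemma map_read_Aux: "map (read ini) (map Aux gs) = gs"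
  by (induction gs) auto

text \<open>
  With \<open>n\<close> cells, a pass together with the turn at its end takes \<open>n + 1\<close> steps; the run consists
  of \<open>N\<close> pairs of passes and a final forward pass.
\<close>

lemma halts_computation:
  assumes "halts s gs N v" "s \<in> S" "set ys \<subseteq> cells" "map (read ini) ys = gs"
  shows "\<exists>tp h. (lba_step automaton ^^ (N * (2 * length gs + 2) + length gs + 1))
    (Forward s, tape ys, 1) (Halted v, tp, h)"
  using assms
proof (induction arbitrary: ys rule: halts.induct)
  case (verdict s gs s' gs' v)
  have len: "length ys = length gs" using verdict.prems(3) by auto
  have run: "(lba_step automaton ^^ length gs) (Forward s, tape ys, 1)
     (Forward s', tape (map Aux gs'), Suc (length gs)) \<and> s' \<in> S"
    using forward_sweep[OF verdict.prems(1,2), of "[]"] verdict by (simp add: len)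
  have len': "length gs' = length gs" using length_sweep[of fwd s gs] verdict by simp
  have "lba_step automaton (Forward s', tape (map Aux gs'), Suc (length gs))
      (Halted v, tape (map Aux gs'), Suc (length gs))"
    unfolding step_iff tape_def using transitions.halt[of s' v] run verdict.hyps(2)
    by (intro conjI exI) (auto simp: nth_append list_update_append len')
  then show ?case using run by (auto intro: relpowp_Suc_I)
next
  case (cycle s gs s' gs' b b' gs'' N v)
  have len: "length ys = length gs" using cycle.prems(3) by auto
  have run1: "(lba_step automaton ^^ length gs) (Forward s, tape ys, 1)
     (Forward s', tape (map Aux gs'), Suc (length gs)) \<and> s' \<in> S \<and> set gs' \<subseteq> G"
    using forward_sweep[OF cycle.prems(1,2), of "[]"] cycle.prems cycle.hyps by (simp add: len)
  have len': "length gs' = length gs" using length_sweep[of fwd s gs] cycle.hyps by simp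
  have step1: "lba_step automaton (Forward s', tape (map Aux gs'), Suc (length gs))
      (Backward b, tape (map Aux gs'), length gs)"
    unfolding step_iff tape_def using transitions.turn_back[of s' b] run1 cycle.hyps(2)
    by (intro conjI exI) (auto simp: nth_append list_update_append len')
  have b: "b \<in> B" using turn run1 cycle.hyps(2) by blast
  have "set (rev (map Aux gs')) \<subseteq> cells" using run1 by (auto simp: cells_def)
  from backward_sweep[OF b this, of "[]"]
  have run2: "(lba_step automaton ^^ length gs) (Backward b, tape (map Aux gs'), length gs)
     (Backward b', tape (map Aux (rev gs'')), 0) \<and> b' \<in> B \<and> set gs'' \<subseteq> G"
    using cycle.hyps(3) by (simp add: len' rev_map map_read_Aux[unfolded map_map] comp_def)
  have len'': "length gs'' = length gs" using length_sweep[of bwd b "rev gs'"] cycle.hyps(3) len' by simp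
  have step2: "lba_step automaton (Backward b', tape (map Aux (rev gs'')), 0)
      (Forward (again b'), tape (map Aux (rev gs'')), 1)"
    unfolding step_iff tape_def using transitions.restart[of b'] run2
    by (intro conjI exI) auto
  have "set (map Aux (rev gs'')) \<subseteq> cells" using run2 by (auto simp: cells_def)
  from cycle.IH[OF _ this map_read_Aux] obtain tp h where
    run3: "(lba_step automaton ^^ (N * (2 * length gs + 2) + length gs + 1))
      (Forward (again b'), tape (map Aux (rev gs'')), 1) (Halted v, tp, h)"
    using run2 again by (auto simp: len'')
  have "(lba_step automaton ^^ (Suc (length gs) + (Suc (length gs) + (N * (2 * length gs + 2) + length gs + 1))))
      (Forward s, tape ys, 1) (Halted v, tp, h)"
    using relpowp_trans[OF relpowp_Suc_I[OF conjunct1[OF run1] step1]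
        relpowp_trans[OF relpowp_Suc_I[OF conjunct1[OF run2] step2] run3]] .
  moreover have "Suc (length gs) + (Suc (length gs) + (N * (2 * length gs + 2) + length gs + 1)) =
      Suc N * (2 * length gs + 2) + length gs + 1" by simp
  ultimately show ?case by metis
qed

theorem lba_exists:
  assumes "\<And>w. \<exists>N \<le> T (length w). halts s0 (map ini w) N (\<phi> w)"
  shows "\<exists>M :: (nat, 'a, nat) lba. is_lba M \<and> lba_language M = {w. \<phi> w} \<and>
    lba_runs_in_time M (\<lambda>n. T n * (2 * n + 2) + n + 1)"
proof -
  have run: "\<exists>N tp h. N \<le> T (length w) * (2 * length w + 2) + length w + 1 \<and>
      (lba_step automaton ^^ N) (lba_initial automaton w) (Halted (\<phi> w), tp, h)" for w
  proof -
    obtain N where N: "N \<le> T (length w)" "halts s0 (map ini w) N (\<phi> w)" using assms by blast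
    have "lba_initial automaton w = (Forward s0, tape (map Letter w), 1)"
      by (simp add: lba_initial_def automaton_def tape_def)
    moreover have "set (map Letter w) \<subseteq> cells" "map (read ini) (map Letter w) = map ini w"
      by (auto simp: cells_def)
    ultimately have "\<exists>tp h. (lba_step automaton ^^ (N * (2 * length w + 2) + length w + 1))
        (lba_initial automaton w) (Halted (\<phi> w), tp, h)"
      using halts_computation[OF N(2) start] by simp
    moreover have "N * (2 * length w + 2) + length w + 1 \<le> T (length w) * (2 * length w + 2) + length w + 1"
      by (rule add_le_mono1[OF add_le_mono1[OF mult_le_mono1[OF N(1)]]])
    ultimately show ?thesis by blast
  qed
  have "lba_runs_in_time automaton (\<lambda>n. T n * (2 * n + 2) + n + 1)"
    unfolding lba_runs_in_time_def
  proof (intro allI impI)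
    fix w n c assume c: "(lba_step automaton ^^ n) (lba_initial automaton w) c"
    obtain N tp h where N: "N \<le> T (length w) * (2 * length w + 2) + length w + 1"
      "(lba_step automaton ^^ N) (lba_initial automaton w) (Halted (\<phi> w), tp, h)" using run by blast
    have "n \<le> N"
      by (rule deterministic_halts(1)[of "lba_step automaton", OF _ N(2) _ c])
        (use step_deterministic halted_stuck in blast)+
    then show "n \<le> T (length w) * (2 * length w + 2) + length w + 1" using N(1) by (rule le_trans)
  qed
  moreover have "lba_language automaton = {w. \<phi> w}"
  proof (intro set_eqI)
    fix w
    obtain N tp h where N: "(lba_step automaton ^^ N) (lba_initial automaton w) (Halted (\<phi> w), tp, h)"
      using run by blast
    have "\<phi> w" if "(lba_step automaton ^^ n) (lba_initial automaton w) c" "fst c = Halted True" for n c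
    proof -
      have stuck: "\<not> lba_step automaton c e" for e
        using that(2) by (cases c) (simp add: halted_stuck)
      have "c = (Halted (\<phi> w), tp, h)"
        by (rule deterministic_halts(2)[of "lba_step automaton", OF _ N _ that(1)])
          (use step_deterministic halted_stuck stuck in blast)+
      then show ?thesis using that(2) by simp
    qed
    moreover have "\<exists>n c. (lba_step automaton ^^ n) (lba_initial automaton w) c \<and> fst c = Halted True" if "\<phi> w"
      by (intro exI[of _ N] exI[of _ "(Halted (\<phi> w), tp, h)"]) (use N that in simp)
    moreover have "lba_accepting automaton = {Halted True}" by (simp add: automaton_def)
    ultimately show "w \<in> lba_language automaton \<longleftrightarrow> w \<in> {w. \<phi> w}"
      unfolding lba_language_iff by auto
  qed
  ultimately show ?thesis using lba_over_nat[OF is_lba_automaton] by force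
qed

end


section \<open>Register machines\<close>

text \<open>
  What a register machine sees in one step: the letters of the input at the values of the registers, and the
  strict comparisons between registers. A register whose value is the length of the input points behind the
  last letter and therefore sees none.
\<close>

type_synonym 'a view = "(nat \<times> 'a) set \<times> (nat \<times> nat) set"

text \<open>Each register receives the old value of some register, or 0, changed by at most one.\<close>

type_synonym update = "nat \<Rightarrow> nat option \<times> move"

definition view :: "nat \<Rightarrow> 'a list \<Rightarrow> (nat \<Rightarrow> nat) \<Rightarrow> 'a view" where
  "view K w r = ({(x, a). x < K \<and> r x < length w \<and> a = w ! r x}, {(x, y). x < K \<and> y < K \<and> r x < r y})"

fun source :: "(nat \<Rightarrow> nat) \<Rightarrow> nat option \<Rightarrow> nat" where
  "source r None = 0"
| "source r (Some y) = r y"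

text \<open>Values are capped at the length \<open>n\<close> of the input, the largest number that \<open>n\<close> cells hold in unary.\<close>

definition apply_update :: "nat \<Rightarrow> update \<Rightarrow> (nat \<Rightarrow> nat) \<Rightarrow> nat \<Rightarrow> nat" where
  "apply_update n u r x = min n (move_head (snd (u x)) (source r (fst (u x))))"

inductive reg_halts ::
  "nat \<Rightarrow> ('q \<Rightarrow> 'a view \<Rightarrow> ('q \<times> update) + bool) \<Rightarrow> 'a list \<Rightarrow> 'q \<Rightarrow> (nat \<Rightarrow> nat) \<Rightarrow> nat \<Rightarrow> bool \<Rightarrow> bool"
  for K \<delta> w where
  verdict: "\<delta> q (view K w r) = Inr v \<Longrightarrow> reg_halts K \<delta> w q r 0 v"
| step: "\<delta> q (view K w r) = Inl (q', u) \<Longrightarrow>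
    reg_halts K \<delta> w q' (apply_update (length w) u r) N v \<Longrightarrow> reg_halts K \<delta> w q r (Suc N) v"

lemma sweep_snoc:
  "sweep \<delta> s (gs @ [g]) =
     (fst (\<delta> (fst (sweep \<delta> s gs)) g), snd (sweep \<delta> s gs) @ [snd (\<delta> (fst (sweep \<delta> s gs)) g)])"
  by (induction gs arbitrary: s) auto

lemma sweep_upt:
  assumes "\<And>i. i < n \<Longrightarrow> \<delta> (st i) (c i) = (st (Suc i), c' i)"
  shows "sweep \<delta> (st 0) (map c [0..<n]) = (st n, map c' [0..<n])"
  using assms by (induction n) (auto simp: sweep_snoc)

lemma sweep_rev_upt:
  assumes "\<And>i. i < n \<Longrightarrow> \<delta> (st (Suc i)) (c i) = (st i, c' i)"
  shows "sweep \<delta> (st n) (rev (map c [0..<n])) = (st 0, rev (map c' [0..<n]))"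
  using assms by (induction n) auto

text \<open>
  The control of a forward pass: the state of the register machine, the registers still to be incremented,
  the registers whose mark was on the previous cell, and the part of the view collected so far.
\<close>

type_synonym ('q, 'a) gather = "'q \<times> nat set \<times> nat set \<times> (nat \<times> 'a) set \<times> (nat \<times> nat) set"

text \<open>
  The control of a backward pass: the state, the view on which it acts, and the registers whose mark was on the
  cell to the right.
\<close>

type_synonym ('q, 'a) rewrite = "'q \<times> (nat \<times> 'a) set \<times> (nat \<times> nat) set \<times> nat set"

locale register_machine =
  fixes K :: nat and \<delta> :: "'q \<Rightarrow> 'a view \<Rightarrow> ('q \<times> update) + bool"
    and Q :: "'q set" and q0 :: 'q
  assumes finite_states: "finite Q" and finite_alphabet: "finite (UNIV :: 'a set)"
    and initial: "q0 \<in> Q"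
    and closed: "q \<in> Q \<Longrightarrow> \<delta> q v = Inl (q', u) \<Longrightarrow> q' \<in> Q"
    and sources: "q \<in> Q \<Longrightarrow> \<delta> q v = Inl (q', u) \<Longrightarrow> x < K \<Longrightarrow> fst (u x) = Some y \<Longrightarrow> y < K"
begin

text \<open>
  In unary, an increment shifts the marks one cell to the right, which needs the previous cell, so it is
  done while moving right. The letter at register \<open>x\<close> stands in the first cell without the mark of \<open>x\<close>,
  and \<open>x\<close> is less than \<open>y\<close> if some cell has the mark of \<open>y\<close> but not that of \<open>x\<close>.
\<close>

fun gather :: "('q, 'a) gather \<Rightarrow> 'a \<times> nat set \<Rightarrow> ('q, 'a) gather \<times> 'a \<times> nat set" where
  "gather (q, I, P, L, C) (a, X) =
     (let Y = {x. x < K \<and> (if x \<in> I then x \<in> P else x \<in> X)} in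
      ((q, I, X, L \<union> {(x, b). x < K \<and> x \<notin> Y \<and> x \<notin> fst ` L \<and> b = a},
        C \<union> {(x, y). x < K \<and> y < K \<and> x \<notin> Y \<and> y \<in> Y}), (a, Y)))"

fun decide :: "('q, 'a) gather \<Rightarrow> ('q, 'a) rewrite + bool" where
  "decide (q, I, P, L, C) =
     (case \<delta> q (L, C) of Inl _ \<Rightarrow> Inl (q, L, C, {}) | Inr v \<Rightarrow> Inr v)"

text \<open>
  Copying and resetting only look at the current cell. A decrement shifts the marks one cell to the left, which
  needs the cell to the right, so it is done while moving left.
\<close>

fun rewrite :: "('q, 'a) rewrite \<Rightarrow> 'a \<times> nat set \<Rightarrow> ('q, 'a) rewrite \<times> 'a \<times> nat set" where
  "rewrite (q, L, C, N) (a, X) =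
     ((q, L, C, X), (a, {x. x < K \<and>
        (case snd (projl (\<delta> q (L, C))) x of (None, _) \<Rightarrow> False
         | (Some y, d) \<Rightarrow> if d = MoveLeft then y \<in> N else y \<in> X)}))"

text \<open>
  Every mark is taken to be present in front of the first cell: incrementing any register marks the first cell.
\<close>

definition gather_start :: "'q \<Rightarrow> nat set \<Rightarrow> ('q, 'a) gather" where
  "gather_start q I = (q, I, {..<K}, {}, {})"

text \<open>The increments of a step are left to the forward pass of the next one.\<close>

fun resume :: "('q, 'a) rewrite \<Rightarrow> ('q, 'a) gather" where
  "resume (q, L, C, N) =
     (case projl (\<delta> q (L, C)) of (q', u) \<Rightarrow> gather_start q' {x. x < K \<and> snd (u x) = MoveRight})"

definition gather_states :: "('q, 'a) gather set" where
  "gather_states = Q \<times> Pow {..<K} \<times> Pow {..<K} \<times> Pow ({..<K} \<times> UNIV) \<times> Pow ({..<K} \<times> {..<K})"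

text \<open>A backward pass only starts if the step is not a verdict, so that \<open>projl\<close> is applied to left summands only.\<close>

definition rewrite_states :: "('q, 'a) rewrite set" where
  "rewrite_states = {(q, L, C, N). (q, L, C, N) \<in> Q \<times> Pow ({..<K} \<times> UNIV) \<times> Pow ({..<K} \<times> {..<K}) \<times> Pow {..<K}
     \<and> isl (\<delta> q (L, C))}"

sublocale sweep_machine gather rewrite decide resume "\<lambda>a. (a, {})" "gather_start q0 {}"
  gather_states rewrite_states "UNIV \<times> Pow {..<K}"
proof
  show "finite gather_states"
    unfolding gather_states_def using finite_states finite_alphabet
    by (intro finite_cartesian_product finite_Pow_iff[THEN iffD2]) auto
  show "finite rewrite_states"
  proof (rule finite_subset)
    show "rewrite_states \<subseteq> Q \<times> Pow ({..<K} \<times> UNIV) \<times> Pow ({..<K} \<times> {..<K}) \<times> Pow {..<K}"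
      unfolding rewrite_states_def by blast
    show "finite (Q \<times> Pow ({..<K} \<times> (UNIV :: 'a set)) \<times> Pow ({..<K} \<times> {..<K}) \<times> Pow {..<K})"
      using finite_states finite_alphabet
      by (intro finite_cartesian_product finite_Pow_iff[THEN iffD2]) auto
  qed
  show "finite ((UNIV :: 'a set) \<times> Pow {..<K})"
    using finite_alphabet by (intro finite_cartesian_product) auto
  show "finite (UNIV :: 'a set)" by (rule finite_alphabet)
  show "gather_start q0 {} \<in> gather_states"
    using initial by (auto simp: gather_start_def gather_states_def)
  show "(a, {}) \<in> UNIV \<times> Pow {..<K}" for a :: 'a by simp
  show "gather s g \<in> gather_states \<times> UNIV \<times> Pow {..<K}" if "s \<in> gather_states" "g \<in> UNIV \<times> Pow {..<K}" for s g
  proof (cases s; cases g)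
    fix q I P L C a X assume "s = (q, I, P, L, C)" "g = (a, X)"
    then show ?thesis using that by (auto simp: gather_states_def Let_def)
  qed
  show "rewrite b g \<in> rewrite_states \<times> UNIV \<times> Pow {..<K}" if "b \<in> rewrite_states" "g \<in> UNIV \<times> Pow {..<K}" for b g
  proof (cases b; cases g)
    fix q L C N a X assume "b = (q, L, C, N)" "g = (a, X)"
    then show ?thesis using that by (auto simp: rewrite_states_def)
  qed
  show "b \<in> rewrite_states" if "s \<in> gather_states" "decide s = Inl b" for s b
  proof (cases s)
    fix q I P L C assume "s = (q, I, P, L, C)"
    then show ?thesis using that
      by (auto simp: rewrite_states_def gather_states_def isl_def split: sum.splits)
  qed
  show "resume b \<in> gather_states" if "b \<in> rewrite_states" for b
  proof (cases b)
    fix q L C N assume b: "b = (q, L, C, N)"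
    then obtain q' u where \<delta>: "\<delta> q (L, C) = Inl (q', u)" "q \<in> Q"
      using \<open>b \<in> rewrite_states\<close> by (auto simp: rewrite_states_def isl_def)
    then show ?thesis using closed[OF \<delta>(2,1)]
      by (auto simp: b gather_states_def gather_start_def)
  qed
qed

definition unary :: "'a list \<Rightarrow> (nat \<Rightarrow> nat) \<Rightarrow> ('a \<times> nat set) list" where
  "unary w r = map (\<lambda>i. (w ! i, {x. x < K \<and> i < r x})) [0..<length w]"

text \<open>
  The tape holds the values \<open>r1\<close>, from which the actual values \<open>r\<close> differ by the pending increments \<open>I\<close>.
  Marks shifted beyond the last cell are lost, which is where the cap comes from.
\<close>

lemma gather_sweep:
  assumes r: "\<And>x. x < K \<Longrightarrow> r x = min (length w) (r1 x + (if x \<in> I then 1 else 0))"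
  shows "\<exists>P. sweep gather (gather_start q I) (unary w r1) =
    ((q, I, P, fst (view K w r), snd (view K w r)), unary w r)"
proof -
  \<comment> \<open>the control after the first \<open>m\<close> cells\<close>
  define st where "st m = (q, I, {x. x < K \<and> (m = 0 \<or> m - 1 < r1 x)},
    {(x, a). x < K \<and> r x < m \<and> a = w ! r x}, {(x, y). x < K \<and> y < K \<and> r x < r y \<and> r x < m})" for m
  have run: "sweep gather (st 0) (unary w r1) = (st (length w), unary w r)"
    unfolding unary_def
  proof (rule sweep_upt)
    fix m assume m: "m < length w"
    have Y: "{x. x < K \<and> (if x \<in> I then x \<in> {x. x < K \<and> (m = 0 \<or> m - 1 < r1 x)} else x \<in> {x. x < K \<and> m < r1 x})}
        = {x. x < K \<and> m < r x}"
      using m by (auto simp: r)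
    have L: "{(x, a). x < K \<and> r x < m \<and> a = w ! r x} \<union>
        {(x, b). x < K \<and> x \<notin> {x. x < K \<and> m < r x} \<and>
           x \<notin> fst ` {(x, a). x < K \<and> r x < m \<and> a = w ! r x} \<and> b = w ! m} =
        {(x, a). x < K \<and> r x < Suc m \<and> a = w ! r x}"
      by (auto simp: image_iff less_Suc_eq)
    have C: "{(x, y). x < K \<and> y < K \<and> r x < r y \<and> r x < m} \<union>
        {(x, y). x < K \<and> y < K \<and> x \<notin> {x. x < K \<and> m < r x} \<and> y \<in> {x. x < K \<and> m < r x}} =
        {(x, y). x < K \<and> y < K \<and> r x < r y \<and> r x < Suc m}"
      by auto
    show "gather (st m) (w ! m, {x. x < K \<and> m < r1 x}) = (st (Suc m), w ! m, {x. x < K \<and> m < r x})"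
      unfolding st_def gather.simps Let_def Y L C by simp
  qed
  have first: "st 0 = gather_start q I" by (auto simp: st_def gather_start_def)
  have "{(x, y). x < K \<and> y < K \<and> r x < r y \<and> r x < length w} = {(x, y). x < K \<and> y < K \<and> r x < r y}"
    by (auto simp: r)
  then have final: "st (length w) = (q, I, {x. x < K \<and> (length w = 0 \<or> length w - 1 < r1 x)},
      fst (view K w r), snd (view K w r))"
    by (simp add: st_def view_def)
  show ?thesis using run unfolding first final by (rule exI)
qed

lemma rewrite_sweep:
  assumes q: "q \<in> Q" and \<delta>: "\<delta> q (view K w r) = Inl (q', u)" and r: "\<And>x. x < K \<Longrightarrow> r x \<le> length w"
    and r1: "\<And>x. x < K \<Longrightarrow> r1 x = (if snd (u x) = MoveLeft then source r (fst (u x)) - 1 else source r (fst (u x)))"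
  shows "\<exists>N. sweep rewrite (q, fst (view K w r), snd (view K w r), {}) (rev (unary w r)) =
    ((q, fst (view K w r), snd (view K w r), N), rev (unary w r1))"
proof -
  \<comment> \<open>the control when the head has \<open>m\<close> cells on its left\<close>
  define st where "st m = (q, fst (view K w r), snd (view K w r), {x. x < K \<and> m < r x})" for m
  have run: "sweep rewrite (st (length w)) (rev (unary w r)) = (st 0, rev (unary w r1))"
    unfolding unary_def
  proof (rule sweep_rev_upt)
    fix m assume m: "m < length w"
    have "{x. x < K \<and> (case u x of (None, _) \<Rightarrow> False
         | (Some y, d) \<Rightarrow> if d = MoveLeft then y \<in> {x. x < K \<and> Suc m < r x} else y \<in> {x. x < K \<and> m < r x})}
        = {x. x < K \<and> m < r1 x}"
    proof (rule Collect_cong, rule conj_cong[OF refl])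
      fix x assume x: "x < K"
      obtain y d where u: "u x = (y, d)" by fastforce
      show "(case u x of (None, _) \<Rightarrow> False
         | (Some y, d) \<Rightarrow> if d = MoveLeft then y \<in> {x. x < K \<and> Suc m < r x} else y \<in> {x. x < K \<and> m < r x})
        \<longleftrightarrow> m < r1 x"
        using sources[OF q \<delta> x] by (cases y) (auto simp: u r1[OF x])
    qed
    then show "rewrite (st (Suc m)) (w ! m, {x. x < K \<and> m < r x}) = (st m, w ! m, {x. x < K \<and> m < r1 x})"
      using \<delta> by (simp add: st_def)
  qed
  have "{x. x < K \<and> length w < r x} = {}" by (auto dest: r)
  then have last: "st (length w) = (q, fst (view K w r), snd (view K w r), {})"
    by (simp only: st_def)
  have "\<exists>N. st 0 = (q, fst (view K w r), snd (view K w r), N)" by (simp add: st_def)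
  then show ?thesis using run unfolding last by force
qed

text \<open>One step of the register machine is one pair of passes.\<close>

lemma reg_halts_sweeps:
  assumes "reg_halts K \<delta> w q r N v" "q \<in> Q"
    "\<And>x. x < K \<Longrightarrow> r x = min (length w) (r1 x + (if x \<in> I then 1 else 0))"
  shows "halts (gather_start q I) (unary w r1) N v"
  using assms
proof (induction arbitrary: I r1 rule: reg_halts.induct)
  case (verdict q r v)
  obtain P where P: "sweep gather (gather_start q I) (unary w r1) =
    ((q, I, P, fst (view K w r), snd (view K w r)), unary w r)" using gather_sweep[OF verdict.prems(2)] by blast
  have "decide (q, I, P, fst (view K w r), snd (view K w r)) = Inr v"
    by (subst decide.simps) (simp add: verdict.hyps)
  then show ?case by (rule halts.verdict[OF P])
next
  case (step q r q' u N v)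
  obtain P where P: "sweep gather (gather_start q I) (unary w r1) =
    ((q, I, P, fst (view K w r), snd (view K w r)), unary w r)" using gather_sweep[OF step.prems(2)] by blast
  have r: "r x \<le> length w" if "x < K" for x using step.prems(2)[OF that] by simp
  define r2 where "r2 x = (if snd (u x) = MoveLeft then source r (fst (u x)) - 1 else source r (fst (u x)))" for x
  obtain N' where N': "sweep rewrite (q, fst (view K w r), snd (view K w r), {}) (rev (unary w r)) =
    ((q, fst (view K w r), snd (view K w r), N'), rev (unary w r2))"
    using rewrite_sweep[OF step.prems(1) step.hyps(1) r, of r2] unfolding r2_def by blast
  have q': "q' \<in> Q" by (rule closed[OF step.prems(1) step.hyps(1)])
  have "halts (gather_start q' {x. x < K \<and> snd (u x) = MoveRight}) (unary w r2) N v"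
  proof (rule step.IH[OF q'])
    fix x assume "x < K"
    then show "apply_update (length w) u r x =
        min (length w) (r2 x + (if x \<in> {x. x < K \<and> snd (u x) = MoveRight} then 1 else 0))"
      by (cases "snd (u x)") (simp_all add: apply_update_def r2_def)
  qed
  then have "halts (resume (q, fst (view K w r), snd (view K w r), N')) (rev (rev (unary w r2))) N v"
    by (simp add: step.hyps(1))
  moreover have "decide (q, I, P, fst (view K w r), snd (view K w r)) =
      Inl (q, fst (view K w r), snd (view K w r), {})"
    by (subst decide.simps) (simp add: step.hyps(1))
  ultimately show ?case by (intro halts.cycle[OF P _ N'])
qed

theorem register_machine_lba:
  assumes "\<And>w. \<exists>N \<le> T (length w). reg_halts K \<delta> w q0 (\<lambda>_. 0) N (\<phi> w)"
  shows "\<exists>M :: (nat, 'a, nat) lba. is_lba M \<and> lba_language M = {w. \<phi> w} \<and>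
    lba_runs_in_time M (\<lambda>n. T n * (2 * n + 2) + n + 1)"
proof (rule lba_exists)
  fix w
  obtain N where N: "N \<le> T (length w)" "reg_halts K \<delta> w q0 (\<lambda>_. 0) N (\<phi> w)" using assms by blast
  have "unary w (\<lambda>_. 0) = map (\<lambda>a. (a, {})) w"
    unfolding unary_def by (auto intro!: nth_equalityI)
  then show "\<exists>N \<le> T (length w). halts (gather_start q0 {}) (map (\<lambda>a. (a, {})) w) N (\<phi> w)"
    using reg_halts_sweeps[OF N(2) initial, of "\<lambda>_. 0" "{}"] N(1) by auto
qed

end


section \<open>Bounded universal quantification\<close>

text \<open>
  Moves on to the next value of register \<open>k\<close>. The registers below \<open>k\<close> are parameters; the ones above \<open>k\<close> are
  the work space of the restarted machine, which expects them to be 0.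
\<close>

definition advance :: "nat \<Rightarrow> update" where
  "advance k x = (if x < k then (Some x, Stay) else if x = k then (Some x, MoveRight) else (None, Stay))"

text \<open>
  Register \<open>k\<close> sees a letter if and only if its value is below the length of the input, that is, if it is not yet
  the last value to be tried.
\<close>

definition forall_machine ::
  "nat \<Rightarrow> 'q \<Rightarrow> ('q \<Rightarrow> 'a view \<Rightarrow> ('q \<times> update) + bool) \<Rightarrow> 'q \<Rightarrow> 'a view \<Rightarrow> ('q \<times> update) + bool" where
  "forall_machine k q0 \<delta> q v =
     (if \<delta> q v = Inr True \<and> k \<in> fst ` fst v then Inl (q0, advance k) else \<delta> q v)"

text \<open>
  The machine never writes to its \<open>k\<close> parameters. Their values at the time of the verdict are then the initial
  ones, so that advancing the last one leads to the next tuple.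
\<close>

definition keeps :: "('q \<Rightarrow> 'a view \<Rightarrow> ('q \<times> update) + bool) \<Rightarrow> nat \<Rightarrow> bool" where
  "keeps \<delta> k \<longleftrightarrow> (\<forall>q v q' u x. \<delta> q v = Inl (q', u) \<longrightarrow> x < k \<longrightarrow> u x = (Some x, Stay))"

text \<open>The initial register contents with \<open>k\<close> parameters bounded by \<open>n\<close>.\<close>

definition tuples :: "nat \<Rightarrow> nat \<Rightarrow> (nat \<Rightarrow> nat) set" where
  "tuples k n = {a. (\<forall>x < k. a x \<le> n) \<and> (\<forall>x \<ge> k. a x = 0)}"

lemma register_machine_forall:
  assumes "register_machine K \<delta> Q q0" "k < K"
  shows "register_machine K (forall_machine k q0 \<delta>) Q q0"
proof -
  interpret register_machine K \<delta> Q q0 by (rule assms(1))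
  show ?thesis
    by unfold_locales
      (use finite_states finite_alphabet initial closed sources assms(2) in
        \<open>auto simp: forall_machine_def advance_def split: if_splits\<close>)
qed

lemma keeps_forall: "keeps \<delta> (Suc k) \<Longrightarrow> keeps (forall_machine k q0 \<delta>) k"
  by (auto simp: keeps_def forall_machine_def advance_def)

lemma view_letters: "k < K \<Longrightarrow> k \<in> fst ` fst (view K w r) \<longleftrightarrow> r k < length w"
  by (force simp: view_def)

text \<open>
  The modified machine follows the original one up to its verdict. It passes the verdict on, except that success
  before the last value of register \<open>k\<close> makes it continue with the next value.
\<close>

lemma forall_machine_continue:
  assumes "reg_halts K \<delta> w q r N v" and "keeps \<delta> (Suc k)" "k < K" "\<forall>x \<le> k. r x \<le> length w"
    and "v \<Longrightarrow> r k < length w \<Longrightarrow>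
      reg_halts K (forall_machine k q0 \<delta>) w q0 (\<lambda>x. if x < k then r x else if x = k then Suc (r k) else 0) N' v'"
  shows "if v \<and> r k < length w then reg_halts K (forall_machine k q0 \<delta>) w q r (N + Suc N') v'
    else reg_halts K (forall_machine k q0 \<delta>) w q r N v"
  using assms
proof (induction rule: reg_halts.induct)
  case (verdict q r v)
  show ?case
  proof (cases "v \<and> r k < length w")
    case True
    have "apply_update (length w) (advance k) r = (\<lambda>x. if x < k then r x else if x = k then Suc (r k) else 0)"
      using verdict.prems(3) True by (auto simp: apply_update_def advance_def)
    moreover have "forall_machine k q0 \<delta> q (view K w r) = Inl (q0, advance k)"
      using verdict True by (simp add: forall_machine_def view_letters)
    ultimately have "reg_halts K (forall_machine k q0 \<delta>) w q r (Suc N') v'"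
      using verdict.prems(4) True by (intro reg_halts.step) auto
    then show ?thesis using True by simp
  next
    case False
    then have "forall_machine k q0 \<delta> q (view K w r) = Inr v"
      using verdict by (auto simp: forall_machine_def view_letters)
    then have "reg_halts K (forall_machine k q0 \<delta>) w q r 0 v" by (rule reg_halts.verdict)
    then show ?thesis using False by (simp only: if_False)
  qed
next
  case (step q r q' u N v)
  have u: "u x = (Some x, Stay)" if "x \<le> k" for x
    using step.prems(1) step.hyps(1) that unfolding keeps_def by (meson less_Suc_eq_le)
  have same: "apply_update (length w) u r x = r x" if "x \<le> k" for x
    using u[OF that] step.prems(3) that by (simp add: apply_update_def)
  have regs: "(\<lambda>x. if x < k then apply_update (length w) u r x else if x = k then Suc (apply_update (length w) u r k) else 0)
      = (\<lambda>x. if x < k then r x else if x = k then Suc (r k) else 0)"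
    by (auto simp: same)
  have \<delta>: "forall_machine k q0 \<delta> q (view K w r) = Inl (q', u)"
    using step.hyps(1) by (simp add: forall_machine_def)
  have "if v \<and> r k < length w
      then reg_halts K (forall_machine k q0 \<delta>) w q' (apply_update (length w) u r) (N + Suc N') v'
      else reg_halts K (forall_machine k q0 \<delta>) w q' (apply_update (length w) u r) N v"
    using step.IH[unfolded regs] step.prems same by simp
  then show ?case using reg_halts.step[of "forall_machine k q0 \<delta>", OF \<delta>] by (auto split: if_splits)
qed

text \<open>
  By descending induction on the current value of register \<open>k\<close>: started there, the machine tests this value and all
  larger ones.
\<close>

lemma forall_machine_decides:
  assumes keeps: "keeps \<delta> (Suc k)" "k < K"
    and dec: "\<And>r. r \<in> tuples (Suc k) (length w) \<Longrightarrow> \<exists>N \<le> T. reg_halts K \<delta> w q0 r N (\<psi> r)"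
    and r: "r \<in> tuples k (length w)"
  shows "\<exists>N \<le> Suc T * Suc (length w).
    reg_halts K (forall_machine k q0 \<delta>) w q0 r N (\<forall>i \<le> length w. \<psi> (r(k := i)))"
proof -
  have tup: "r(k := i) \<in> tuples (Suc k) (length w)" if "i \<le> length w" for i
    using r that by (auto simp: tuples_def)
  have "\<exists>N \<le> Suc T * Suc (length w - i).
      reg_halts K (forall_machine k q0 \<delta>) w q0 (r(k := i)) N (\<forall>j. i \<le> j \<and> j \<le> length w \<longrightarrow> \<psi> (r(k := j)))"
    if "i \<le> length w" for i
    using that
  proof (induction i rule: inc_induct)
    case base
    obtain N where N: "N \<le> T" "reg_halts K \<delta> w q0 (r(k := length w)) N (\<psi> (r(k := length w)))"
      using dec[OF tup[of "length w"]] by auto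
    have "reg_halts K (forall_machine k q0 \<delta>) w q0 (r(k := length w)) N (\<psi> (r(k := length w)))"
      using forall_machine_continue[OF N(2) keeps, of q0] tup[of "length w"] by (simp add: tuples_def)
    moreover have "(\<forall>j. length w \<le> j \<and> j \<le> length w \<longrightarrow> \<psi> (r(k := j))) = \<psi> (r(k := length w))"
      by (auto dest: le_antisym)
    ultimately have "reg_halts K (forall_machine k q0 \<delta>) w q0 (r(k := length w)) N
        (\<forall>j. length w \<le> j \<and> j \<le> length w \<longrightarrow> \<psi> (r(k := j)))" by (simp only:)
    moreover have "N \<le> Suc T * Suc (length w - length w)" using N(1) by simp
    ultimately show ?case by blast
  next
    case (step i)
    obtain N where N: "N \<le> T" "reg_halts K \<delta> w q0 (r(k := i)) N (\<psi> (r(k := i)))"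
      using dec[OF tup[of i]] step.hyps by auto
    obtain N' where N': "N' \<le> Suc T * Suc (length w - Suc i)" "reg_halts K (forall_machine k q0 \<delta>) w q0 (r(k := Suc i)) N'
        (\<forall>j. Suc i \<le> j \<and> j \<le> length w \<longrightarrow> \<psi> (r(k := j)))" using step.IH by blast
    have next_tuple: "(\<lambda>x. if x < k then (r(k := i)) x else if x = k then Suc ((r(k := i)) k) else 0) = r(k := Suc i)"
      using r by (auto simp: tuples_def)
    have split: "(\<forall>j. i \<le> j \<and> j \<le> length w \<longrightarrow> \<psi> (r(k := j))) \<longleftrightarrow>
        \<psi> (r(k := i)) \<and> (\<forall>j. Suc i \<le> j \<and> j \<le> length w \<longrightarrow> \<psi> (r(k := j)))"
      using step.hyps by (metis Suc_leD le_antisym less_imp_le_nat not_less_eq_eq)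
    have bound: "\<forall>x \<le> k. (r(k := i)) x \<le> length w" using tup[of i] step.hyps by (simp add: tuples_def)
    have "if \<psi> (r(k := i)) \<and> (r(k := i)) k < length w
      then reg_halts K (forall_machine k q0 \<delta>) w q0 (r(k := i)) (N + Suc N') (\<forall>j. Suc i \<le> j \<and> j \<le> length w \<longrightarrow> \<psi> (r(k := j)))
      else reg_halts K (forall_machine k q0 \<delta>) w q0 (r(k := i)) N (\<psi> (r(k := i)))"
      by (rule forall_machine_continue[OF N(2) keeps bound]) (unfold next_tuple, rule N'(2))
    then have "\<exists>N'' \<le> N + Suc N'. reg_halts K (forall_machine k q0 \<delta>) w q0 (r(k := i)) N''
        (\<forall>j. i \<le> j \<and> j \<le> length w \<longrightarrow> \<psi> (r(k := j)))"
      unfolding split using step.hyps by (cases "\<psi> (r(k := i))") (auto intro: exI[of _ N])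
    moreover have "N + Suc N' \<le> Suc T * Suc (length w - i)"
      using N(1) N'(1) step.hyps Suc_diff_Suc[of i "length w"] by simp
    ultimately show ?case by (meson le_trans)
  qed
  from this[of 0] have "\<exists>N \<le> Suc T * Suc (length w).
      reg_halts K (forall_machine k q0 \<delta>) w q0 (r(k := 0)) N (\<forall>j \<le> length w. \<psi> (r(k := j)))"
    by simp
  moreover have "r(k := 0) = r" using r by (auto simp: tuples_def)
  ultimately show ?thesis by simp
qed

lemma all_tuples_Suc:
  "(\<forall>a \<in> tuples (Suc k) n. \<psi> a) \<longleftrightarrow> (\<forall>a \<in> tuples k n. \<forall>i \<le> n. \<psi> (a(k := i)))"
proof safe
  fix a i assume "\<forall>a \<in> tuples (Suc k) n. \<psi> a" "a \<in> tuples k n" "i \<le> n"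
  then show "\<psi> (a(k := i))" by (auto simp: tuples_def)
next
  fix a assume *: "\<forall>a \<in> tuples k n. \<forall>i \<le> n. \<psi> (a(k := i))" and a: "a \<in> tuples (Suc k) n"
  have "a(k := 0) \<in> tuples k n" using a by (auto simp: tuples_def Suc_le_eq intro: le_neq_implies_less)
  moreover have "a k \<le> n" using a by (auto simp: tuples_def)
  ultimately have "\<psi> ((a(k := 0))(k := a k))" using * by blast
  then show "\<psi> a" by simp
qed

text \<open>
  Each quantifier multiplies the running time by the number of values, so for a fixed number \<open>k\<close> of parameters
  it stays polynomial.
\<close>

theorem lba_forall_tuples:
  fixes \<delta> :: "'q \<Rightarrow> 'a view \<Rightarrow> ('q \<times> update) + bool" and P :: "nat poly"
  assumes "register_machine K \<delta> Q q0" "k \<le> K" "keeps \<delta> k"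
    and "\<And>w r. r \<in> tuples k (length w) \<Longrightarrow> \<exists>N \<le> poly P (length w). reg_halts K \<delta> w q0 r N (\<psi> w r)"
  shows "\<exists>(M :: (nat, 'a, nat) lba) (P :: nat poly).
    is_lba M \<and> lba_language M = {w. \<forall>a \<in> tuples k (length w). \<psi> w a} \<and> lba_runs_in_time M (poly P)"
  using assms
proof (induction k arbitrary: \<delta> \<psi> P)
  case 0
  interpret register_machine K \<delta> Q q0 by (rule 0)
  have t: "tuples 0 n = {\<lambda>_. 0}" for n by (auto simp: tuples_def)
  have "\<exists>M :: (nat, 'a, nat) lba. is_lba M \<and> lba_language M = {w. \<psi> w (\<lambda>_. 0)} \<and>
    lba_runs_in_time M (\<lambda>n. poly P n * (2 * n + 2) + n + 1)"
    by (rule register_machine_lba) (use 0 in \<open>simp add: t\<close>)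
  moreover have "(\<lambda>n. poly P n * (2 * n + 2) + n + 1) = poly (P * [:2, 2:] + [:1, 1:])"
    by (auto simp: algebra_simps)
  ultimately show ?case unfolding t by auto
next
  case (Suc k)
  have k: "k < K" using Suc.prems by simp
  have "\<exists>N \<le> poly ((P + 1) * [:1, 1:]) (length w).
      reg_halts K (forall_machine k q0 \<delta>) w q0 r N (\<forall>i \<le> length w. \<psi> w (r(k := i)))"
    if "r \<in> tuples k (length w)" for w r
  proof -
    have "poly ((P + 1) * [:1, 1:]) (length w) = Suc (poly P (length w)) * Suc (length w)" by simp
    then show ?thesis using forall_machine_decides[OF Suc.prems(3) k Suc.prems(4) that] by (simp only:)
  qed
  then show ?case unfolding all_tuples_Suc
    by (rule Suc.IH[OF register_machine_forall[OF Suc.prems(1) k] less_imp_le[OF k] keeps_forall[OF Suc.prems(3)]])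
qed


section \<open>Scanning a codeword with marked letters\<close>

datatype status = Open | Closed | Invalid

text \<open>
  The scan decides whether \<open>m\<close> given letters of the input are an occurrence of a pattern. Its registers are:
  the positions of these letters, numbered from 0 to \<open>m - 1\<close>; the current position \<open>m\<close>; the number \<open>m + 1\<close> of
  letters \<open>t\<close> just read; the balance \<open>m + 2\<close>; the constant zero \<open>m + 3\<close>, with which the balance is compared;
  and for each \<open>j\<close> below \<open>m\<close>, in register \<open>m + 4 + j\<close>, the number of open slots to the left of the entry of
  the \<open>j\<close>-th letter, once this letter has been read.

  The finite control records which of the letters have been read, the pairs \<open>(i, j)\<close> of such letters for which the
  entry of the \<open>i\<close>-th is to the left of the entry of the \<open>j\<close>-th, and whether the input read so far is a
  codeword (\<open>Closed\<close>), still has an open slot and obeys the bound on the runs of \<open>t\<close> (\<open>Open\<close>), or neither.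
\<close>

type_synonym scan_control = "nat set \<times> (nat \<times> nat) set \<times> status"

text \<open>The effect of a letter on the number of open slots.\<close>

definition shift :: "it_letter \<Rightarrow> move" where
  "shift x = (if x = Lm then MoveRight else if x = Lf then MoveLeft else Stay)"

text \<open>
  \<open>J\<close> holds the given letters at the current position, and \<open>F\<close> the ones whose entries are to the right of
  the slot being filled. Only these have one slot more or less to their left afterwards. To the left of the
  new entry are as many slots as letters \<open>t\<close> were read, and one more if the letter leaves a slot there.
\<close>

definition scan_update :: "nat \<Rightarrow> it_letter \<Rightarrow> nat set \<Rightarrow> nat set \<Rightarrow> update" where
  "scan_update m x J F y =
     (if y = m then (Some m, MoveRight)
      else if y = m + 1 then (if x = Lt then (Some (m + 1), MoveRight) else (None, Stay))
      else if y = m + 2 then (Some (m + 2), shift x)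
      else if m + 4 \<le> y \<and> x \<noteq> Lt then
        (if y - (m + 4) \<in> J then (Some (m + 1), if x = Lr \<or> x = Lm then MoveRight else Stay)
         else (Some y, if y - (m + 4) \<in> F then shift x else Stay))
      else (Some y, Stay))"

text \<open>
  The flags \<open>ok\<close> and \<open>z\<close> say that the slot to be filled exists and that the balance is 0. The word is complete
  when a letter \<open>f\<close> fills the last slot, and no letter may follow.
\<close>

definition scan_control ::
  "it_letter \<Rightarrow> nat set \<Rightarrow> nat set \<Rightarrow> bool \<Rightarrow> bool \<Rightarrow> scan_control \<Rightarrow> scan_control" where
  "scan_control x J F ok z c =
     (if x = Lt then fst c else fst c \<union> J,
      if x = Lt then fst (snd c) else fst (snd c) \<union> (fst c - F) \<times> J \<union> J \<times> (fst c \<inter> F),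
      if snd (snd c) \<noteq> Open then Invalid else if x = Lt then Open else if \<not> ok then Invalid
      else if x = Lf \<and> z then Closed else Open)"

text \<open>
  \<open>D\<close> and \<open>R\<close> are the letters that have been read and the left-to-right order of their entries. Entries are
  inserted in increasing order, so comparing the positions of the letters, as \<open>C\<close> does, compares the entries.
\<close>

definition occurs :: "real list \<Rightarrow> nat set \<Rightarrow> (nat \<times> nat) set \<Rightarrow> (nat \<times> nat) set \<Rightarrow> bool" where
  "occurs q D R C \<longleftrightarrow> {..<length q} \<subseteq> D \<and>
     (\<forall>i j. i < j \<and> j < length q \<longrightarrow> (i, j) \<in> R \<and> ((i, j) \<in> C \<longleftrightarrow> q ! i < q ! j))"

text \<open>
  The letter at the current position drives the scan; at the end of the input there is none. Registers below
  \<open>m\<close> are never changed, so their comparisons at the end give the order of the values.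
\<close>

definition scan_machine ::
  "nat \<Rightarrow> real list set \<Rightarrow> scan_control \<Rightarrow> it_letter view \<Rightarrow> (scan_control \<times> update) + bool" where
  "scan_machine m qs = (\<lambda>(D, R, st) (L, C).
     if \<exists>x. (m, x) \<in> L then
       let x = (THE x. (m, x) \<in> L);
           J = {i. i < m \<and> (i, m) \<notin> C \<and> (m, i) \<notin> C};
           F = {i. i < m \<and> (m + 1, m + 4 + i) \<in> C}
       in Inl (scan_control x J F ((m + 2, m + 1) \<notin> C) ((m + 3, m + 2) \<notin> C) (D, R, st),
               scan_update m x J F)
     else Inr (st = Closed \<and> (\<forall>q \<in> qs. \<not> occurs q D R C)))"

definition scan_states :: "nat \<Rightarrow> scan_control set" where
  "scan_states m = Pow {..<m} \<times> Pow ({..<m} \<times> {..<m}) \<times> UNIV"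

lemma finite_status: "finite (UNIV :: status set)"
proof -
  have "(UNIV :: status set) = {Open, Closed, Invalid}" using status.exhaust by blast
  then show ?thesis by (metis finite.emptyI finite.insertI)
qed

lemma finite_it_letter: "finite (UNIV :: it_letter set)"
proof -
  have "(UNIV :: it_letter set) = {Ll, Lr, Lm, Lf, Lt}" using it_letter.exhaust by blast
  then show ?thesis by (metis finite.emptyI finite.insertI)
qed

lemma scan_update_source:
  "fst (scan_update m x J F y) = Some z \<Longrightarrow> y < 2 * m + 4 \<Longrightarrow> z < 2 * m + 4"
  by (auto simp: scan_update_def split: if_splits)

lemma register_machine_scan:
  "register_machine (2 * m + 4) (scan_machine m qs) (scan_states m) ({}, {}, Open)"
proof
  show "finite (scan_states m)" unfolding scan_states_def
    using finite_status by (intro finite_cartesian_product finite_Pow_iff[THEN iffD2]) auto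
  show "finite (UNIV :: it_letter set)" by (rule finite_it_letter)
  show "({}, {}, Open) \<in> scan_states m" by (simp add: scan_states_def)
  fix c v c' u assume c: "c \<in> scan_states m" and step: "scan_machine m qs c v = Inl (c', u)"
  obtain D R st L C where cv: "c = (D, R, st)" "v = (L, C)" by (metis prod_cases3 surj_pair)
  define J where "J = {i. i < m \<and> (i, m) \<notin> C \<and> (m, i) \<notin> C}"
  define F where "F = {i. i < m \<and> (m + 1, m + 4 + i) \<in> C}"
  define x where "x = (THE x. (m, x) \<in> L)"
  have J: "J \<subseteq> {..<m}" by (auto simp: J_def)
  have c': "c' = scan_control x J F ((m + 2, m + 1) \<notin> C) ((m + 3, m + 2) \<notin> C) c"
    and u: "u = scan_update m x J F"
    using step unfolding cv scan_machine_def prod.case Let_def J_def[symmetric] F_def[symmetric] x_def[symmetric]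
    by (simp_all split: if_splits)
  show "c' \<in> scan_states m" using c J unfolding c'
    by (auto simp: scan_states_def scan_control_def split: prod.splits)
  show "y' < 2 * m + 4" if "y < 2 * m + 4" "fst (u y) = Some y'" for y y'
    using scan_update_source that unfolding u by blast
qed

lemma keeps_scan: "keeps (scan_machine m qs) m"
  by (auto simp: keeps_def scan_machine_def Let_def scan_update_def split: if_splits)

text \<open>
  The effect of one letter on control and registers, without the cap on the registers. This makes the scan a
  function of the prefix that has been read, independent of the rest of the input.
\<close>

definition letter_step ::
  "nat \<Rightarrow> it_letter \<Rightarrow> scan_control \<times> (nat \<Rightarrow> nat) \<Rightarrow> scan_control \<times> (nat \<Rightarrow> nat)" where
  "letter_step m x = (\<lambda>(c, r).
     let J = {i. i < m \<and> r i = r m}; F = {i. i < m \<and> r (m + 1) < r (m + 4 + i)} in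
     (scan_control x J F (r (m + 1) \<le> r (m + 2)) (r (m + 2) \<le> r (m + 3)) c,
      \<lambda>y. move_head (snd (scan_update m x J F y)) (source r (fst (scan_update m x J F y)))))"

definition scan :: "nat \<Rightarrow> (nat \<Rightarrow> nat) \<Rightarrow> it_letter list \<Rightarrow> scan_control \<times> (nat \<Rightarrow> nat)" where
  "scan m a u = fold (letter_step m) u (({}, {}, Open), a)"

lemma scan_snoc: "scan m a (u @ [x]) = letter_step m x (scan m a u)"
  by (simp add: scan_def)

definition scan_regs :: "nat \<Rightarrow> (nat \<Rightarrow> nat) \<Rightarrow> it_letter list \<Rightarrow> nat \<Rightarrow> nat" where
  "scan_regs m a u = snd (scan m a u)"

lemma scan_regs_Nil: "scan_regs m a [] = a"
  by (simp add: scan_regs_def scan_def)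

abbreviation marked_here where
  "marked_here m r \<equiv> {i. i < m \<and> r i = r m}"

abbreviation right_of_slot where
  "right_of_slot m r \<equiv> {i. i < m \<and> r (m + 1) < r (m + 4 + i)}"

lemma scan_regs_snoc:
  "scan_regs m a (u @ [x]) y =
     (let r = scan_regs m a u; upd = scan_update m x (marked_here m r) (right_of_slot m r) y
      in move_head (snd upd) (source r (fst upd)))"
  by (simp add: scan_regs_def scan_snoc letter_step_def Let_def split: prod.splits)

lemma scan_control_snoc:
  "fst (scan m a (u @ [x])) =
     (let r = scan_regs m a u in
      scan_control x (marked_here m r) (right_of_slot m r)
        (r (m + 1) \<le> r (m + 2)) (r (m + 2) \<le> r (m + 3)) (fst (scan m a u)))"
  by (simp add: scan_regs_def scan_snoc letter_step_def Let_def split: prod.splits)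

lemma scan_regs_fixed:
  assumes "a \<in> tuples m n"
  shows "(\<forall>y < m. scan_regs m a u y = a y) \<and> scan_regs m a u m = length u
    \<and> scan_regs m a u (m + 1) = trailing_ts u \<and> scan_regs m a u (m + 3) = 0"
proof (induction u rule: rev_induct)
  case Nil
  then show ?case using assms by (simp add: scan_regs_Nil tuples_def trailing_ts_Nil)
next
  case (snoc x u)
  then show ?case by (simp add: scan_regs_snoc scan_update_def Let_def trailing_ts_snoc)
qed

lemma move_head_le: "move_head d h \<le> Suc h"
  by (cases d) auto

text \<open>
  Every register grows by at most one with each letter, so none exceeds the length of the prefix that has been
  read, and the cap at the length of the input never takes effect.
\<close>

lemma scan_regs_le:
  assumes "a \<in> tuples m n" "m \<le> y"
  shows "scan_regs m a u y \<le> length u"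
  using assms(2)
proof (induction u arbitrary: y rule: rev_induct)
  case Nil
  then show ?case using assms(1) by (simp add: scan_regs_Nil tuples_def)
next
  case (snoc x u)
  define upd where "upd = scan_update m x (marked_here m (scan_regs m a u)) (right_of_slot m (scan_regs m a u)) y"
  have "source (scan_regs m a u) (fst upd) \<le> length u"
    using snoc by (auto simp: upd_def scan_update_def)
  moreover have "scan_regs m a (u @ [x]) y = move_head (snd upd) (source (scan_regs m a u) (fst upd))"
    unfolding scan_regs_snoc Let_def upd_def ..
  ultimately show ?case using move_head_le[of "snd upd" "source (scan_regs m a u) (fst upd)"] by simp
qed

lemma view_at:
  "(x, y) \<in> snd (view K w r) \<longleftrightarrow> x < K \<and> y < K \<and> r x < r y"
  "(x, b) \<in> fst (view K w r) \<longleftrightarrow> x < K \<and> r x < length w \<and> b = w ! r x"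
  by (auto simp: view_def)

lemma scan_machine_step:
  assumes a: "a \<in> tuples m (length w)" and w: "w = u @ x # v"
  shows "\<exists>U. scan_machine m qs (fst (scan m a u)) (view (2 * m + 4) w (scan_regs m a u)) =
      Inl (fst (scan m a (u @ [x])), U)
    \<and> apply_update (length w) U (scan_regs m a u) = scan_regs m a (u @ [x])"
proof -
  let ?r = "scan_regs m a u"
  let ?V = "view (2 * m + 4) w ?r"
  obtain D R st where c: "fst (scan m a u) = (D, R, st)" by (cases "fst (scan m a u)") auto
  have r: "?r m = length u" using scan_regs_fixed[OF a] by blast
  have x: "(m, b) \<in> fst ?V \<longleftrightarrow> b = x" for b unfolding view_at r w by simp
  have J: "{i. i < m \<and> (i, m) \<notin> snd ?V \<and> (m, i) \<notin> snd ?V} = marked_here m ?r"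
    unfolding view_at by auto
  have F: "{i. i < m \<and> (m + 1, m + 4 + i) \<in> snd ?V} = right_of_slot m ?r"
    unfolding view_at by auto
  have ok: "(m + 2, m + 1) \<notin> snd ?V \<longleftrightarrow> ?r (m + 1) \<le> ?r (m + 2)"
    "(m + 3, m + 2) \<notin> snd ?V \<longleftrightarrow> ?r (m + 2) \<le> ?r (m + 3)"
    unfolding view_at by auto
  have step: "scan_machine m qs (D, R, st) (fst ?V, snd ?V) =
      Inl (fst (scan m a (u @ [x])), scan_update m x (marked_here m ?r) (right_of_slot m ?r))"
    unfolding scan_machine_def prod.case Let_def x J F ok scan_control_snoc c by simp
  have regs: "apply_update (length w) (scan_update m x (marked_here m ?r) (right_of_slot m ?r)) ?r y =
      scan_regs m a (u @ [x]) y" for y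
  proof -
    have "scan_regs m a (u @ [x]) y \<le> length w"
    proof (cases "m \<le> y")
      case True
      then show ?thesis using scan_regs_le[OF a True, of "u @ [x]"] by (simp add: w)
    next
      case False
      then show ?thesis using scan_regs_fixed[OF a, of "u @ [x]"] a by (simp add: tuples_def)
    qed
    then show ?thesis by (simp add: apply_update_def scan_regs_snoc Let_def)
  qed
  show ?thesis
    by (rule exI, rule conjI) (rule step[unfolded prod.collapse, folded c], rule ext, rule regs)
qed

definition verdict :: "nat \<Rightarrow> real list set \<Rightarrow> it_letter list \<Rightarrow> (nat \<Rightarrow> nat) \<Rightarrow> bool" where
  "verdict m qs w a = (case fst (scan m a w) of (D, R, st) \<Rightarrow>
     st = Closed \<and> (\<forall>q \<in> qs. \<not> occurs q D R {(i, j). i < m \<and> j < m \<and> a i < a j}))"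

lemma occurs_cong:
  assumes "\<And>i j. i < m \<Longrightarrow> j < m \<Longrightarrow> (i, j) \<in> C \<longleftrightarrow> (i, j) \<in> C'" "D \<subseteq> {..<m}"
  shows "occurs q D R C \<longleftrightarrow> occurs q D R C'"
proof (cases "{..<length q} \<subseteq> D")
  case True
  then have "{..<length q} \<subseteq> {..<m}" using assms(2) by (rule subset_trans)
  then have "(i, j) \<in> C \<longleftrightarrow> (i, j) \<in> C'" if "i < j" "j < length q" for i j
    using assms(1)[of i j] that by simp
  then show ?thesis unfolding occurs_def by blast
qed (simp add: occurs_def)

lemma scan_control_subset: "fst (fst (scan m a u)) \<subseteq> {..<m}"
proof (induction u rule: rev_induct)
  case (snoc x u)
  then show ?case unfolding scan_control_snoc by (auto simp: scan_control_def Let_def split: prod.splits)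
qed (simp add: scan_def)

lemma scan_machine_halts:
  assumes a: "a \<in> tuples m (length w)"
  shows "reg_halts (2 * m + 4) (scan_machine m qs) w ({}, {}, Open) a (length w) (verdict m qs w a)"
proof -
  have "reg_halts (2 * m + 4) (scan_machine m qs) w (fst (scan m a u)) (scan_regs m a u) (length v) (verdict m qs w a)"
    if "w = u @ v" for u v
    using that
  proof (induction v arbitrary: u)
    case Nil
    let ?V = "view (2 * m + 4) w (scan_regs m a w)"
    obtain D R st where c: "fst (scan m a w) = (D, R, st)" by (cases "fst (scan m a w)") auto
    have "occurs q D R (snd ?V) \<longleftrightarrow> occurs q D R {(i, j). i < m \<and> j < m \<and> a i < a j}" for q
    proof (rule occurs_cong)
      show "D \<subseteq> {..<m}" using scan_control_subset[of m a w] by (simp add: c)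
      show "(i, j) \<in> snd ?V \<longleftrightarrow> (i, j) \<in> {(i, j). i < m \<and> j < m \<and> a i < a j}" if "i < m" "j < m" for i j
        using scan_regs_fixed[OF a, of w] that by (simp add: view_at)
    qed
    moreover have "(m, b) \<notin> fst ?V" for b using scan_regs_fixed[OF a, of w] by (simp add: view_at)
    ultimately have "scan_machine m qs (D, R, st) (fst ?V, snd ?V) = Inr (verdict m qs w a)"
      unfolding scan_machine_def verdict_def prod.case c by simp
    then show ?case using Nil c by (auto intro: reg_halts.verdict)
  next
    case (Cons x v)
    obtain U where U: "scan_machine m qs (fst (scan m a u)) (view (2 * m + 4) w (scan_regs m a u)) =
        Inl (fst (scan m a (u @ [x])), U)" "apply_update (length w) U (scan_regs m a u) = scan_regs m a (u @ [x])"
      using scan_machine_step[OF a Cons.prems] by blast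
    show ?case using reg_halts.step[of "scan_machine m qs", OF U(1)] Cons.IH[of "u @ [x]"] Cons.prems U(2) by simp
  qed
  from this[of "[]" w] show ?thesis by (simp add: scan_regs_Nil scan_def)
qed


section \<open>Recognising codewords\<close>

text \<open>
  An admissible word has a nonnegative balance before each letter other than \<open>t\<close>, so the balance can reach
  \<open>-1\<close> only with the last such letter; for a word that ends with it, this is what makes it a codeword.
\<close>

lemma scan_status:
  assumes a: "a \<in> tuples m n"
  shows "(snd (snd (fst (scan m a u))) = Open \<longleftrightarrow> admissible u \<and> 0 \<le> balance u)
    \<and> (snd (snd (fst (scan m a u))) = Closed \<longleftrightarrow> u \<in> it_codewords)
    \<and> (snd (snd (fst (scan m a u))) = Open \<longrightarrow> int (scan_regs m a u (m + 2)) = balance u)"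
proof (induction u rule: rev_induct)
  case Nil
  then show ?case using a
    by (simp add: scan_def scan_regs_Nil admissible_Nil balance_def it_codewords_eq tuples_def)
next
  case (snoc x u)
  let ?st = "snd (snd (fst (scan m a u)))" and ?r = "scan_regs m a u"
  have regs: "?r (m + 1) = trailing_ts u" "?r (m + 3) = 0" using scan_regs_fixed[OF a] by blast+
  have st: "snd (snd (fst (scan m a (u @ [x])))) =
      (if ?st \<noteq> Open then Invalid else if x = Lt then Open else if \<not> trailing_ts u \<le> ?r (m + 2) then Invalid
       else if x = Lf \<and> ?r (m + 2) = 0 then Closed else Open)"
    by (auto simp: scan_control_snoc scan_control_def Let_def regs[simplified])
  have bal: "scan_regs m a (u @ [x]) (m + 2) = move_head (shift x) (?r (m + 2))"
    by (simp add: scan_regs_snoc Let_def scan_update_def)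
  show ?case
  proof (cases "?st = Open")
    case True
    then have b: "int (?r (m + 2)) = balance u" "admissible u" "0 \<le> balance u" using snoc by auto
    show ?thesis
      using True b unfolding st bal it_codewords_eq mem_Collect_eq admissible_snoc balance_snoc
      by (cases x) (auto simp: shift_def)
  next
    case False
    then have "\<not> (admissible u \<and> 0 \<le> balance u)" using snoc by blast
    then show ?thesis
      using False unfolding st it_codewords_eq mem_Collect_eq admissible_snoc balance_snoc
      by (cases x) auto
  qed
qed

section \<open>Positions of the marked entries\<close>

text \<open>The number that a letter at position \<open>k\<close> inserts.\<close>

definition entry :: "it_letter list \<Rightarrow> nat \<Rightarrow> nat" where
  "entry u k = Suc (length (filter (\<lambda>x. x \<noteq> Lt) (take k u)))"

definition slots_before :: "real option list \<Rightarrow> nat \<Rightarrow> nat" where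
  "slots_before P e = count_list (takeWhile (\<lambda>y. y \<noteq> Some (real e)) P) None"

definition precedes :: "real option list \<Rightarrow> nat \<Rightarrow> nat \<Rightarrow> bool" where
  "precedes P d e \<longleftrightarrow> Some (real d) \<in> set (takeWhile (\<lambda>y. y \<noteq> Some (real e)) P)"

lemma entry_append: "k \<le> length u \<Longrightarrow> entry (u @ v) k = entry u k"
  by (simp add: entry_def)

lemma entry_less:
  assumes "j < k" "j < length u" "u ! j \<noteq> Lt"
  shows "entry u j < entry u k"
proof -
  have "k = Suc j + (k - Suc j)" using assms(1) by simp
  then have "take k u = take (Suc j) u @ take (k - Suc j) (drop (Suc j) u)" by (metis take_add)
  then have "take k u = take j u @ [u ! j] @ take (k - Suc j) (drop (Suc j) u)"
    using assms(2) by (simp add: take_Suc_conv_app_nth)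
  then show ?thesis using assms(3) by (simp add: entry_def)
qed

lemma entry_less_iff:
  assumes "j < length u" "u ! j \<noteq> Lt" "k < length u" "u ! k \<noteq> Lt"
  shows "entry u j < entry u k \<longleftrightarrow> j < k"
  using entry_less[of j k u] entry_less[of k j u] assms by (metis less_asym less_irrefl nat_neq_iff)

lemma entry_range:
  assumes "builds u P i" "k < length u" "u ! k \<noteq> Lt"
  shows "1 \<le> entry u k" "entry u k < i"
proof -
  have "entry u k < entry u (length u)" using entry_less[of k "length u" u] assms by simp
  then show "entry u k < i" using builds_index[OF assms(1)] by (simp add: entry_def)
qed (simp add: entry_def)

lemma entry_in_list:
  assumes "builds u P i" "k < length u" "u ! k \<noteq> Lt"
  shows "Some (real (entry u k)) \<in> set P"
proof -
  have "Some (real (entry u k)) \<in> (Some \<circ> real) ` {1..<i}"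
    using entry_range[OF assms] by simp
  then show ?thesis using conjunct1[OF builds_entries[OF assms(1)]] by auto
qed

lemma entry_surj:
  "1 \<le> e \<Longrightarrow> e \<le> length (filter (\<lambda>x. x \<noteq> Lt) u) \<Longrightarrow> \<exists>k < length u. u ! k \<noteq> Lt \<and> entry u k = e"
proof (induction u rule: rev_induct)
  case (snoc x u)
  show ?case
  proof (cases "e \<le> length (filter (\<lambda>x. x \<noteq> Lt) u)")
    case True
    then obtain k where "k < length u" "u ! k \<noteq> Lt" "entry u k = e" using snoc by blast
    then show ?thesis by (intro exI[of _ k]) (simp add: nth_append entry_append)
  next
    case False
    then have "x \<noteq> Lt \<and> e = Suc (length (filter (\<lambda>x. x \<noteq> Lt) u))" using snoc.prems by (auto split: if_splits)
    then show ?thesis by (intro exI[of _ "length u"]) (simp add: entry_def)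
  qed
qed simp

lemma takeWhile_in: "z \<in> set A \<Longrightarrow> takeWhile (\<lambda>y. y \<noteq> z) (A @ B) = takeWhile (\<lambda>y. y \<noteq> z) A"
  by (rule takeWhile_append1) auto

lemma takeWhile_notin: "z \<notin> set A \<Longrightarrow> takeWhile (\<lambda>y. y \<noteq> z) (A @ B) = A @ takeWhile (\<lambda>y. y \<noteq> z) B"
  by (rule takeWhile_append2) auto

lemma count_list_takeWhile: "count_list (takeWhile Q A) z \<le> count_list A z"
  by (induction A) auto

lemma block_notin: "e \<noteq> i \<Longrightarrow> Some (real e) \<notin> set (block x i)"
  by (auto simp: block_def left_slots_def right_slots_def)

text \<open>
  The following lemmas describe a block filling the slot after \<open>A\<close>. An entry is in \<open>A\<close> if and only if at
  most \<open>count_list A None\<close> slots precede it, and the block then does not affect this number.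
\<close>

lemma slots_before_left:
  assumes "Some (real e) \<in> set A"
  shows "slots_before (A @ B) e \<le> count_list A None" "slots_before (A @ B) e = slots_before (A @ B') e"
  using assms by (simp_all add: slots_before_def takeWhile_in count_list_takeWhile)

lemma slots_before_right:
  assumes "Some (real e) \<notin> set A" "e \<noteq> i" "x \<noteq> Lt"
  shows "count_list A None < slots_before (A @ None # B) e"
    "slots_before (A @ block x i @ B) e = move_head (shift x) (slots_before (A @ None # B) e)"
proof -
  have *: "slots_before (A @ None # B) e = Suc (count_list A None + slots_before B e)"
    using assms(1) by (simp add: slots_before_def takeWhile_notin)
  then show "count_list A None < slots_before (A @ None # B) e" by simp
  have "slots_before (A @ block x i @ B) e = count_list A None + (count_list (block x i) None + slots_before B e)"
    using assms by (simp add: slots_before_def takeWhile_notin block_notin)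
  then show "slots_before (A @ block x i @ B) e = move_head (shift x) (slots_before (A @ None # B) e)"
    using assms(3) count_slots_block[OF assms(3), of i] * by (cases x) (auto simp: shift_def)
qed

lemma slots_before_new:
  assumes "Some (real i) \<notin> set A"
  shows "slots_before (A @ block x i @ B) i = count_list A None + (if x = Lr \<or> x = Lm then 1 else 0)"
  using assms by (simp add: slots_before_def takeWhile_notin block_def left_slots_def)

lemma precedes_insert:
  assumes "d \<noteq> i" "e \<noteq> i"
  shows "precedes (A @ block x i @ B) d e \<longleftrightarrow> precedes (A @ None # B) d e"
proof (cases "Some (real e) \<in> set A")
  case True
  then show ?thesis by (simp add: precedes_def takeWhile_in)
next
  case False
  then show ?thesis using assms by (simp add: precedes_def takeWhile_notin block_notin)
qed

lemma precedes_new_right: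
  assumes "Some (real i) \<notin> set A" "d \<noteq> i"
  shows "precedes (A @ block x i @ B) d i \<longleftrightarrow> Some (real d) \<in> set A"
  using assms by (simp add: precedes_def takeWhile_notin block_def left_slots_def)

lemma precedes_new_left:
  assumes "Some (real i) \<notin> set A" "e \<noteq> i"
  shows "precedes (A @ block x i @ B) i e \<longleftrightarrow> Some (real e) \<notin> set A"
proof (cases "Some (real e) \<in> set A")
  case True
  then show ?thesis using assms by (auto simp: precedes_def takeWhile_in dest: set_takeWhileD)
next
  case False
  then show ?thesis using assms
    by (simp add: precedes_def takeWhile_notin block_notin) (simp add: block_def)
qed

lemma precedes_irrefl: "\<not> precedes P e e"
  by (auto simp: precedes_def dest: set_takeWhileD)

definition marked :: "nat \<Rightarrow> (nat \<Rightarrow> nat) \<Rightarrow> it_letter list \<Rightarrow> nat set" where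
  "marked m a u = {j. j < m \<and> a j < length u \<and> u ! a j \<noteq> Lt}"

text \<open>
  What control and registers mean after complete blocks: the letters that have been read, the order of their entries
  in the partial permutation \<open>P\<close>, and the slots to the left of these entries.
\<close>

definition scan_inv :: "nat \<Rightarrow> (nat \<Rightarrow> nat) \<Rightarrow> it_letter list \<Rightarrow> real option list \<Rightarrow> bool" where
  "scan_inv m a u P \<longleftrightarrow>
     fst (fst (scan m a u)) = marked m a u \<and>
     fst (snd (fst (scan m a u))) = {(i, j). i \<in> marked m a u \<and> j \<in> marked m a u \<and>
        precedes P (entry u (a i)) (entry u (a j))} \<and>
     (\<forall>j \<in> marked m a u. scan_regs m a u (m + 4 + j) = slots_before P (entry u (a j)))"

lemma scan_translate:
  "fst (fst (scan m a (u @ replicate k Lt))) = fst (fst (scan m a u)) \<and>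
   fst (snd (fst (scan m a (u @ replicate k Lt)))) = fst (snd (fst (scan m a u))) \<and>
   scan_regs m a (u @ replicate k Lt) (m + 4 + j) = scan_regs m a u (m + 4 + j)"
proof (induction k)
  case (Suc k)
  have "u @ replicate (Suc k) Lt = (u @ replicate k Lt) @ [Lt]"
    by (simp add: replicate_append_same)
  then show ?case using Suc
    by (simp only: scan_control_snoc scan_regs_snoc)
      (simp add: scan_control_def scan_update_def Let_def)
qed simp

text \<open>
  After the letters \<open>t\<close> of the block, the number of them is the number of slots in \<open>A\<close>. The comparison with
  the counter of an earlier letter thus tells whether its entry is to the left of the slot, in \<open>A\<close>, or to the
  right, and the new entry is placed relative to it accordingly. The order of two earlier entries does not change.
\<close>

lemma scan_inv_insert:
  assumes a: "a \<in> tuples m n" and b: "builds u (A @ None # B) i" and x: "x \<noteq> Lt"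
    and inv: "scan_inv m a u (A @ None # B)"
  shows "scan_inv m a (u @ replicate (count_list A None) Lt @ [x]) (A @ block x i @ B)"
proof -
  let ?s = "count_list A None"
  let ?v = "u @ replicate ?s Lt"
  let ?u' = "u @ replicate ?s Lt @ [x]"
  let ?P = "A @ None # B" and ?P' = "A @ block x i @ B"
  let ?D = "marked m a u"
  define J where "J = {j. j < m \<and> a j = length ?v}"
  define F where "F = {j. j < m \<and> ?s < scan_regs m a u (m + 4 + j)}"
  have u': "?u' = ?v @ [x]" by simp
  have run: "trailing_ts ?v = ?s" using trailing_ts_builds[OF b] by (simp add: trailing_ts_translate)
  have J: "marked_here m (scan_regs m a ?v) = J"
    using scan_regs_fixed[OF a, of ?v] by (auto simp: J_def)
  have F: "right_of_slot m (scan_regs m a ?v) = F"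
    using scan_regs_fixed[OF a, of ?v] scan_translate[of m a u ?s] by (simp add: F_def run)
  have D': "marked m a ?u' = ?D \<union> J"
    using x unfolding marked_def J_def by (auto simp: nth_append less_Suc_eq split: if_splits)
  have disj: "?D \<inter> J = {}" by (auto simp: marked_def J_def)
  have old: "entry ?u' (a j) = entry u (a j)" "entry u (a j) \<noteq> i" "Some (real (entry u (a j))) \<in> set ?P"
    if "j \<in> ?D" for j
    using that entry_append[of "a j" u] entry_range(2)[OF b, of "a j"] entry_in_list[OF b, of "a j"]
    by (auto simp: marked_def simp del: set_append)
  have new: "entry ?u' (a j) = i" if "j \<in> J" for j
    using that builds_index[OF b] by (simp add: J_def entry_def)
  have fresh: "Some (real i) \<notin> set A" using builds_fresh[OF b] by simp
  have left: "scan_regs m a u (m + 4 + j) = slots_before ?P (entry u (a j))" if "j \<in> ?D" for j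
    using inv that by (simp add: scan_inv_def)
  have F_iff: "j \<in> F \<longleftrightarrow> Some (real (entry u (a j))) \<notin> set A" if "j \<in> ?D" for j
  proof (cases "Some (real (entry u (a j))) \<in> set A")
    case True
    then show ?thesis using slots_before_left(1)[OF True, of "None # B"] left[OF that] by (simp add: F_def)
  next
    case False
    then show ?thesis using slots_before_right(1)[OF False old(2)[OF that] x] left[OF that] that
      by (simp add: F_def marked_def)
  qed
  have "fst (fst (scan m a ?u')) = fst (fst (scan m a ?v)) \<union> J"
    unfolding u' scan_control_snoc Let_def J by (simp add: scan_control_def x)
  then have placed: "fst (fst (scan m a ?u')) = marked m a ?u'"
    using inv scan_translate[of m a u ?s] unfolding D' by (simp add: scan_inv_def)
  have "fst (snd (fst (scan m a ?u'))) = fst (snd (fst (scan m a ?v))) \<union>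
      (fst (fst (scan m a ?v)) - F) \<times> J \<union> J \<times> (fst (fst (scan m a ?v)) \<inter> F)"
    unfolding u' scan_control_snoc Let_def J F by (simp add: scan_control_def x)
  then have R': "fst (snd (fst (scan m a ?u'))) =
      {(i, j). i \<in> ?D \<and> j \<in> ?D \<and> precedes ?P (entry u (a i)) (entry u (a j))} \<union> (?D - F) \<times> J \<union> J \<times> (?D \<inter> F)"
    using inv scan_translate[of m a u ?s] by (simp add: scan_inv_def)
  have "(j, k) \<in> fst (snd (fst (scan m a ?u'))) \<longleftrightarrow>
      j \<in> marked m a ?u' \<and> k \<in> marked m a ?u' \<and> precedes ?P' (entry ?u' (a j)) (entry ?u' (a k))" for j k
  proof -
    consider "j \<in> ?D" "k \<in> ?D" | "j \<in> ?D" "k \<in> J" | "j \<in> J" "k \<in> ?D" | "j \<in> J" "k \<in> J" | "j \<notin> ?D \<union> J \<or> k \<notin> ?D \<union> J"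
      by blast
    then show ?thesis
    proof cases
      case 1
      then show ?thesis using disj precedes_insert[of _ i _ A x B] by (auto simp: R' D' old)
    next
      case 2
      then show ?thesis using disj precedes_new_right[OF fresh, of _ x B] F_iff[of j] by (auto simp: R' D' old new)
    next
      case 3
      then show ?thesis using disj precedes_new_left[OF fresh, of _ x B] F_iff[of k] by (auto simp: R' D' old new)
    next
      case 4
      then show ?thesis using disj precedes_irrefl by (auto simp: R' D' new)
    next
      case 5
      then show ?thesis by (auto simp: R' D')
    qed
  qed
  then have rel: "fst (snd (fst (scan m a ?u'))) = {(j, k). j \<in> marked m a ?u' \<and> k \<in> marked m a ?u' \<and>
      precedes ?P' (entry ?u' (a j)) (entry ?u' (a k))}" by auto
  have "scan_regs m a ?u' (m + 4 + j) = slots_before ?P' (entry ?u' (a j))" if "j \<in> marked m a ?u'" for j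
  proof (cases "j \<in> J")
    case True
    have "scan_regs m a ?u' (m + 4 + j) = (if x = Lr \<or> x = Lm then Suc ?s else ?s)"
      unfolding u' scan_regs_snoc Let_def J using True x scan_regs_fixed[OF a, of ?v] run
      by (simp add: scan_update_def)
    then show ?thesis using slots_before_new[OF fresh, of x B] new[OF True] by simp
  next
    case False
    then have j: "j \<in> ?D" using that D' by blast
    have "scan_regs m a ?u' (m + 4 + j) = move_head (if j \<in> F then shift x else Stay) (scan_regs m a ?v (m + 4 + j))"
      unfolding u' scan_regs_snoc Let_def J F using False x by (simp add: scan_update_def)
    then have r: "scan_regs m a ?u' (m + 4 + j) =
        move_head (if j \<in> F then shift x else Stay) (slots_before ?P (entry u (a j)))"
      using scan_translate[of m a u ?s j] left[OF j] by simp
    show ?thesis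
    proof (cases "Some (real (entry u (a j))) \<in> set A")
      case True
      then show ?thesis using r F_iff[OF j] old(1)[OF j] slots_before_left(2)[OF True, of "None # B"] by simp
    next
      case notin: False
      then show ?thesis using r F_iff[OF j] old(1)[OF j] slots_before_right(2)[OF notin old(2)[OF j] x] by simp
    qed
  qed
  then show ?thesis using placed rel by (simp add: scan_inv_def)
qed

lemma builds_scan_inv:
  assumes "builds u P i" "a \<in> tuples m n"
  shows "scan_inv m a u P"
  using assms
proof (induction rule: builds.induct)
  case init
  then show ?case by (simp add: scan_inv_def scan_def marked_def)
next
  case (insert u A B i x)
  then show ?case using scan_inv_insert by blast
qed


section \<open>Occurrences of patterns\<close>

lemma set_subseq: "subseq s p \<Longrightarrow> set s \<subseteq> set p"
  by (auto elim: list_emb_set)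

text \<open>
  Whether a list is a subsequence of a list without repetitions can be tested on single elements and pairs: \<open>y\<close> precedes \<open>z\<close>
  if it is met before the first \<open>z\<close>.
\<close>

lemma subseq_if_precedes:
  assumes "sorted_wrt (\<lambda>y z. y \<in> set (takeWhile (\<lambda>t. t \<noteq> z) p)) s" "set s \<subseteq> set p"
  shows "subseq s p"
  using assms
proof (induction p arbitrary: s)
  case (Cons t p)
  show ?case
  proof (cases s)
    case (Cons y s')
    have y: "y \<in> set (takeWhile (\<lambda>t. t \<noteq> z) (t # p))" if "z \<in> set s'" for z
      using Cons.prems(1) that unfolding Cons by simp
    then have t: "z \<noteq> t" if "z \<in> set s'" for z using that by force
    have pairs: "sorted_wrt (\<lambda>y z. y \<in> set (takeWhile (\<lambda>t. t \<noteq> z) p)) s'"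
    proof (rule sorted_wrt_mono_rel)
      show "sorted_wrt (\<lambda>y z. y \<in> set (takeWhile (\<lambda>t. t \<noteq> z) (t # p))) s'"
        using Cons.prems(1) unfolding Cons by simp
      show "x \<in> set (takeWhile (\<lambda>t. t \<noteq> z) p)"
        if "x \<in> set s'" "z \<in> set s'" "x \<in> set (takeWhile (\<lambda>t. t \<noteq> z) (t # p))" for x z
        using that t[of x] t[of z] by simp
    qed
    have sub: "set s' \<subseteq> set p" using Cons.prems(2) t unfolding Cons by auto
    show ?thesis
    proof (cases "y = t")
      case True
      then show ?thesis using Cons.IH[OF pairs sub] unfolding Cons by simp
    next
      case False
      have "y \<in> set (takeWhile (\<lambda>t. t \<noteq> z) p)" if "z \<in> set s'" for z
        using y[OF that] t[OF that] False by simp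
      then have "sorted_wrt (\<lambda>y z. y \<in> set (takeWhile (\<lambda>t. t \<noteq> z) p)) s"
        using pairs unfolding Cons by simp
      moreover have "set s \<subseteq> set p" using Cons.prems(2) sub False unfolding Cons by simp
      ultimately have "subseq s p" by (rule Cons.IH)
      then show ?thesis by (rule list_emb_Cons)
    qed
  qed simp
qed simp

lemma precedes_if_subseq:
  assumes "subseq s p" "distinct p"
  shows "sorted_wrt (\<lambda>y z. y \<in> set (takeWhile (\<lambda>t. t \<noteq> z) p)) s"
  using assms
proof (induction p arbitrary: s rule: list.induct)
  case (Cons t p)
  have weaken: "sorted_wrt (\<lambda>y z. y \<in> set (takeWhile (\<lambda>t. t \<noteq> z) (t # p))) s'" if s': "subseq s' p" for s'
  proof (rule sorted_wrt_mono_rel[OF _ Cons.IH[OF s']])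
    fix y z assume "z \<in> set s'" "y \<in> set (takeWhile (\<lambda>t. t \<noteq> z) p)"
    moreover have "z \<noteq> t" using \<open>z \<in> set s'\<close> set_subseq[OF s'] Cons.prems(2) by auto
    ultimately show "y \<in> set (takeWhile (\<lambda>t. t \<noteq> z) (t # p))" by simp
  qed (use Cons.prems in simp)
  show ?case
  proof (cases "subseq s p")
    case True
    then show ?thesis by (rule weaken)
  next
    case False
    then obtain s' where s: "s = t # s'" "subseq s' p"
      using Cons.prems(1) by (cases s) (auto split: if_splits)
    have "z \<noteq> t" if "z \<in> set s'" for z using that set_subseq[OF s(2)] Cons.prems(2) by auto
    then show ?thesis using weaken[OF s(2)] unfolding s(1) by auto
  qed
qed (auto dest: list_emb_Nil2)

lemma precedes_map_Some:
  "precedes (map Some p) d e \<longleftrightarrow> real d \<in> set (takeWhile (\<lambda>y. y \<noteq> real e) p)"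
  by (auto simp: precedes_def takeWhile_map comp_def)

lemma verdict_codeword:
  assumes w: "w \<in> it_codewords" and a: "a \<in> tuples m (length w)"
  shows "verdict m qs w a \<longleftrightarrow> (\<forall>q \<in> qs. \<not> occurs q (marked m a w)
    {(i, j). i \<in> marked m a w \<and> j \<in> marked m a w \<and>
      precedes (map Some (it_perm w)) (entry w (a i)) (entry w (a j))}
    {(i, j). i < m \<and> j < m \<and> a i < a j})"
proof -
  obtain i where "builds w (map Some (it_perm w)) (Suc i)" using codeword_builds[OF w] by blast
  from builds_scan_inv[OF this a] have "fst (fst (scan m a w)) = marked m a w"
    "fst (snd (fst (scan m a w))) = {(i, j). i \<in> marked m a w \<and> j \<in> marked m a w \<and>
      precedes (map Some (it_perm w)) (entry w (a i)) (entry w (a j))}"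
    by (simp_all add: scan_inv_def)
  moreover have "snd (snd (fst (scan m a w))) = Closed" using scan_status[OF a, of w] w by blast
  ultimately show ?thesis by (cases "fst (scan m a w)") (simp add: verdict_def)
qed

text \<open>
  The scan compares positions in the codeword; for letters other than \<open>t\<close>, they are ordered like the entries that they insert.
\<close>

lemma occurs_iff:
  assumes "length q \<le> m"
  shows "occurs q (marked m a w)
    {(i, j). i \<in> marked m a w \<and> j \<in> marked m a w \<and>
      precedes (map Some p) (entry w (a i)) (entry w (a j))}
    {(i, j). i < m \<and> j < m \<and> a i < a j} \<longleftrightarrow>
   (\<forall>i < length q. a i < length w \<and> w ! a i \<noteq> Lt) \<and>
   (\<forall>i j. i < j \<and> j < length q \<longrightarrow>
      precedes (map Some p) (entry w (a i)) (entry w (a j)) \<and> (entry w (a i) < entry w (a j) \<longleftrightarrow> q ! i < q ! j))"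
proof -
  have D: "{..<length q} \<subseteq> marked m a w \<longleftrightarrow> (\<forall>i < length q. a i < length w \<and> w ! a i \<noteq> Lt)"
    using assms by (auto simp: marked_def)
  show ?thesis
  proof (cases "{..<length q} \<subseteq> marked m a w")
    case True
    then have letters: "a i < length w" "w ! a i \<noteq> Lt" "i < m" "i \<in> marked m a w" if "i < length q" for i
      using D assms that by auto
    have "entry w (a i) < entry w (a j) \<longleftrightarrow> a i < a j" if "i < length q" "j < length q" for i j
      using entry_less_iff letters that by blast
    then have "(i, j) \<in> {(i, j). i < m \<and> j < m \<and> a i < a j} \<longleftrightarrow> entry w (a i) < entry w (a j)"
      "(i, j) \<in> {(i, j). i \<in> marked m a w \<and> j \<in> marked m a w \<and>
         precedes (map Some p) (entry w (a i)) (entry w (a j))} \<longleftrightarrow>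
       precedes (map Some p) (entry w (a i)) (entry w (a j))"
      if "i < j \<and> j < length q" for i j
      using that letters[of i] letters[of j] by simp_all
    then show ?thesis unfolding occurs_def D by (simp cong: imp_cong conj_cong)
  next
    case False
    then show ?thesis unfolding occurs_def D by blast
  qed
qed

text \<open>
  The number \<open>m\<close> of available letters may exceed the length of the pattern, so that one scan serves patterns
  of different lengths; the positions beyond the length of the pattern are then arbitrary, for example 0.
\<close>

lemma contains_pattern_iff:
  assumes w: "w \<in> it_codewords" and q: "length q \<le> m"
  shows "contains_pattern (it_perm w) q \<longleftrightarrow> (\<exists>a \<in> tuples m (length w).
   (\<forall>i < length q. a i < length w \<and> w ! a i \<noteq> Lt) \<and>
   (\<forall>i j. i < j \<and> j < length q \<longrightarrow> precedes (map Some (it_perm w)) (entry w (a i)) (entry w (a j)) \<and>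
      (entry w (a i) < entry w (a j) \<longleftrightarrow> q ! i < q ! j)))"
  (is "_ \<longleftrightarrow> (\<exists>a \<in> _. ?occ a)")
proof -
  obtain n where b: "builds w (map Some (it_perm w)) (Suc n)" using codeword_builds[OF w] by blast
  have p: "distinct (it_perm w)" "set (it_perm w) = real ` {1..n}"
    using builds_perms_of[OF b] by (auto simp: perms_of_def is_perm_def)
  have n: "n = length (filter (\<lambda>x. x \<noteq> Lt) w)" using builds_index[OF b] by simp
  show ?thesis
  proof
    assume "contains_pattern (it_perm w) q"
    then obtain s where s: "subseq s (it_perm w)" "length s = length q"
      and iso: "\<And>i j. i < j \<Longrightarrow> j < length q \<Longrightarrow> s ! i < s ! j \<longleftrightarrow> q ! i < q ! j"
      unfolding contains_pattern_def order_isomorphic_def by metis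
    have "\<exists>k < length w. w ! k \<noteq> Lt \<and> real (entry w k) = s ! i" if "i < length q" for i
    proof -
      have "s ! i \<in> set (it_perm w)" using set_subseq[OF s(1)] s(2) that by (metis nth_mem subsetD)
      then obtain e where e: "1 \<le> e" "e \<le> n" "s ! i = real e" unfolding p(2) by auto
      then show ?thesis using entry_surj[of e w] unfolding n by metis
    qed
    then obtain f where f: "\<And>i. i < length q \<Longrightarrow> f i < length w \<and> w ! f i \<noteq> Lt \<and> real (entry w (f i)) = s ! i"
      by metis
    define a where "a i = (if i < length q then f i else 0)" for i
    have "a \<in> tuples m (length w)" using f q by (auto simp: a_def tuples_def less_imp_le)
    moreover have "?occ a"
    proof (intro conjI allI impI)
      fix i j assume ij: "i < j \<and> j < length q"
      have "s ! i \<in> set (takeWhile (\<lambda>t. t \<noteq> s ! j) (it_perm w))"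
        using sorted_wrt_nth_less[OF precedes_if_subseq[OF s(1) p(1)], of i j] ij s(2) by simp
      then show "precedes (map Some (it_perm w)) (entry w (a i)) (entry w (a j))"
        using f[of i] f[of j] ij unfolding precedes_map_Some a_def by simp
      have "real (entry w (a i)) < real (entry w (a j)) \<longleftrightarrow> q ! i < q ! j"
        using f[of i] f[of j] ij iso[of i j] by (simp add: a_def)
      then show "entry w (a i) < entry w (a j) \<longleftrightarrow> q ! i < q ! j" by simp
    qed (use f in \<open>auto simp: a_def\<close>)
    ultimately show "\<exists>a \<in> tuples m (length w). ?occ a" by blast
  next
    assume "\<exists>a \<in> tuples m (length w). ?occ a"
    then obtain a where a: "?occ a" by blast
    define s where "s = map (\<lambda>i. real (entry w (a i))) [0..<length q]"
    have "set s \<subseteq> set (it_perm w)"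
    proof
      fix y assume "y \<in> set s"
      then obtain i where i: "i < length q" "y = real (entry w (a i))" by (auto simp: s_def)
      have "Some y \<in> set (map Some (it_perm w))" using entry_in_list[OF b, of "a i"] a i by simp
      then show "y \<in> set (it_perm w)" by auto
    qed
    moreover have "sorted_wrt (\<lambda>y z. y \<in> set (takeWhile (\<lambda>t. t \<noteq> z) (it_perm w))) s"
      using a unfolding sorted_wrt_iff_nth_less precedes_map_Some by (simp add: s_def)
    ultimately have "subseq s (it_perm w)" by (intro subseq_if_precedes)
    moreover have "order_isomorphic s q"
      using a by (simp add: order_isomorphic_def s_def)
    ultimately show "contains_pattern (it_perm w) q" unfolding contains_pattern_def by blast
  qed
qed

text \<open>
  Every scan also checks that its input is a codeword. As there is at least one tuple, even for \<open>m = 0\<close>,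
  this check takes place also when no pattern is given.
\<close>

lemma all_verdicts_iff:
  assumes "\<forall>q \<in> qs. length q \<le> m"
  shows "(\<forall>a \<in> tuples m (length w). verdict m qs w a) \<longleftrightarrow>
    w \<in> it_codewords \<and> (\<forall>q \<in> qs. avoids (it_perm w) q)"
proof (cases "w \<in> it_codewords")
  case True
  have "(\<forall>a \<in> tuples m (length w). verdict m qs w a) \<longleftrightarrow>
    (\<forall>q \<in> qs. \<not> contains_pattern (it_perm w) q)"
  proof -
    have "(\<forall>a \<in> tuples m (length w). verdict m qs w a) \<longleftrightarrow>
      (\<forall>q \<in> qs. \<forall>a \<in> tuples m (length w). \<not> occurs q (marked m a w)
        {(i, j). i \<in> marked m a w \<and> j \<in> marked m a w \<and>
          precedes (map Some (it_perm w)) (entry w (a i)) (entry w (a j))}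
        {(i, j). i < m \<and> j < m \<and> a i < a j})"
      using verdict_codeword[OF True] by blast
    also have "\<dots> \<longleftrightarrow> (\<forall>q \<in> qs. \<not> contains_pattern (it_perm w) q)"
    proof (rule ball_cong[OF refl])
      fix q assume "q \<in> qs"
      then have q: "length q \<le> m" using assms by blast
      show "(\<forall>a \<in> tuples m (length w). \<not> occurs q (marked m a w)
        {(i, j). i \<in> marked m a w \<and> j \<in> marked m a w \<and>
          precedes (map Some (it_perm w)) (entry w (a i)) (entry w (a j))}
        {(i, j). i < m \<and> j < m \<and> a i < a j}) \<longleftrightarrow> \<not> contains_pattern (it_perm w) q"
        unfolding contains_pattern_iff[OF True q] occurs_iff[OF q] by blast
    qed
    finally show ?thesis .
  qed
  then show ?thesis using True by (simp add: avoids_def)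
next
  case False
  have zero: "(\<lambda>_. 0) \<in> tuples m (length w)" by (simp add: tuples_def)
  have "snd (snd (fst (scan m (\<lambda>_. 0) w))) \<noteq> Closed" using scan_status[OF zero, of w] False by blast
  then have "\<not> verdict m qs w (\<lambda>_. 0)" by (auto simp: verdict_def)
  then show ?thesis using zero False by blast
qed

section \<open>The encoding and the automaton\<close>

theorem corollary9:
  fixes qs :: "real list list"
  assumes "\<forall>q \<in> set qs. is_perm q"
  defines "L \<equiv> it_codewords \<inter> (\<Inter>q \<in> set qs. it_avoiding q)"
  shows "bij_betw it_perm L (\<Union>n \<in> {1..}. {p \<in> perms_of n. \<forall>q \<in> set qs. avoids p q})
    \<and> (\<exists>(M :: (nat, it_letter, nat) lba) (P :: nat poly).
          is_lba M \<and> lba_language M = L \<and> lba_runs_in_time M (poly P))"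
proof
  have L: "L = {w \<in> it_codewords. \<forall>q \<in> set qs. avoids (it_perm w) q}"
    unfolding L_def it_avoiding_def by auto
  show "bij_betw it_perm L (\<Union>n \<in> {1..}. {p \<in> perms_of n. \<forall>q \<in> set qs. avoids p q})"
    unfolding L by (rule bij_betw_it_perm_restrict)
  \<comment> \<open>any common bound for the lengths of the patterns\<close>
  define m where "m = sum_list (map length qs)"
  have m: "\<forall>q \<in> set qs. length q \<le> m" by (auto simp: m_def intro: member_le_sum_list)
  have "\<exists>(M :: (nat, it_letter, nat) lba) (P :: nat poly).
    is_lba M \<and> lba_language M = {w. \<forall>a \<in> tuples m (length w). verdict m (set qs) w a} \<and> lba_runs_in_time M (poly P)"
  proof (rule lba_forall_tuples[OF register_machine_scan _ keeps_scan, where P = "[:0, 1:]"])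
    fix w :: "it_letter list" and a assume "a \<in> tuples m (length w)"
    then show "\<exists>N \<le> poly [:0, 1:] (length w).
        reg_halts (2 * m + 4) (scan_machine m (set qs)) w ({}, {}, Open) a N (verdict m (set qs) w a)"
      using scan_machine_halts by auto
  qed simp
  then show "\<exists>(M :: (nat, it_letter, nat) lba) (P :: nat poly).
      is_lba M \<and> lba_language M = L \<and> lba_runs_in_time M (poly P)"
    unfolding all_verdicts_iff[OF m] L .
qed

end
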